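(* Let $n$ be a positive integer and let $\varphi:\mathbb{Z}[U]\to Q_n$ be the ring homomorphism with $\varphi(z_{ij})=H_{i-j}^{(j)}$ for $1\le j<i\le n$. For all $1\le j<i\le n$, $$\varphi(\nu_{i,j})=(-1)^{i-j}q_{ji},\qquad \varphi(\xi_{i,j})=F_{i-1,j}$$ in $Q_n$.
   Context: Fix a positive integer $n$. Let $R_n=\mathbb{Z}[x_1,\ldots,x_n,q_{ij}\mid 1\le i<j\le n]$. For $0\le j\le n$ let $M_j$ be the $j\times j$ matrix with diagonal entries $x_1,\ldots,x_j$, with $(a,b)$ entry $q_{ab}$ for $a<b$, with entries $-1$ in positions $(a+1,a)$, and $0$ elsewhere. Define $E_i^{(j)}\in R_n$ by $\det(tI_j-M_j)=\sum_{i=0}^{j}(-1)^iE_i^{(j)}t^{j-i}$, with $E_0^{(j)}=1$ and $E_i^{(j)}=0$ unless $0\le i\le j$. Put $Q_n=R_n/(E_1^{(n)},\ldots,E_n^{(n)})$; an element of $R_n$ and its image in $Q_n$ are denoted by the same symbol. $\mathbf{q}$-quantization: let $e_i^{(j)}=e_i(x_1,\ldots,x_j)$ be the elementary symmetric polynomial ($e_0^{(j)}=1$, $e_i^{(j)}=0$ unless $0\le i\le j$). The standard elementary monomials $e_{i_1,\ldots,i_m}=e_{i_1}^{(1)}\cdots e_{i_m}^{(m)}$ ($0\le i_k\le k$; sequences differing by trailing zeros are identified) form a $\mathbb{Z}$-basis of $\mathbb{Z}[x_1,x_2,\ldots]$. If $f=\sum c_{i_1,\ldots,i_m}e_{i_1,\ldots,i_m}$,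 its $\mathbf{q}$-quantization is $F=\sum c_{i_1,\ldots,i_m}E_{i_1}^{(1)}\cdots E_{i_m}^{(m)}$ (it lies in $R_n$ when only indices $m\le n$ occur, which is the case here). $H_i^{(j)}$ is the $\mathbf{q}$-quantization of the complete symmetric polynomial $h_i^{(j)}=h_i(x_1,\ldots,x_j)$. For $i\ge j\ge1$, $F_{i,j}$ is the $\mathbf{q}$-quantization of $$f_{i,j}=\sum_{k=1}^{j}\Big(\prod_{\ell=j+1}^{i}(x_k-x_\ell)\Big)x_k$$ (empty product $=1$). $\mathbb{Z}[U]=\mathbb{Z}[z_{ij}\mid 1\le j<i\le n]$; $z=(z_{ij})$ is the $n\times n$ lower unipotent matrix with $z_{ii}=1$ and $z_{ij}=0$ for $i<j$. $N$ is the $n\times n$ matrix with $1$ in positions $(a,a+1)$ and $0$ elsewhere, and $S=\mathrm{diag}(1,2,\ldots,n)$. For $1\le j<i\le n$, $\nu_{i,j}=(z^{-1}Nz)_{ij}$ and $\xi_{i,j}=(z^{-1}Sz)_{ij}$ in $\mathbb{Z}[U]$. *)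

theory Defs
  imports
    "HOL-Library.Poly_Mapping"
    "HOL-Library.Multiset"
    "HOL-Algebra.QuotRing"
    "Jordan_Normal_Form.Char_Poly"
begin

section \<open>Integral polynomial rings\<close>

text \<open>Polynomials with integer coefficients in indeterminates of type \<open>'v\<close>: finitely
  supported coefficient functions on finitely supported exponent functions.\<close>

type_synonym 'v zpoly = "('v \<Rightarrow>\<^sub>0 nat) \<Rightarrow>\<^sub>0 int"

definition var :: "'v \<Rightarrow> 'v zpoly" where
  "var v = Poly_Mapping.single (Poly_Mapping.single v 1) 1"

text \<open>The polynomial ring over the integers in the indeterminates from \<open>V\<close>.\<close>

definition zpoly_ring :: "'v set \<Rightarrow> 'v zpoly ring" where
  "zpoly_ring V =
    \<lparr>carrier = {p. \<forall>m \<in> Poly_Mapping.keys p. Poly_Mapping.keys m \<subseteq> V},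
     monoid.mult = (*), one = 1, zero = 0, add = (+)\<rparr>"


section \<open>The ring \<open>Q\<^sub>n\<close>\<close>

text \<open>\<open>X k\<close> stands for \<open>x\<^sub>k\<close> and \<open>Q a b\<close> for \<open>q\<^sub>a\<^sub>b\<close>.\<close>

datatype xq = X nat | Q nat nat

abbreviation xvar :: "nat \<Rightarrow> xq zpoly" where
  "xvar k \<equiv> var (X k)"

abbreviation qvar :: "nat \<Rightarrow> nat \<Rightarrow> xq zpoly" where
  "qvar a b \<equiv> var (Q a b)"

definition R_ring :: "nat \<Rightarrow> xq zpoly ring" where
  "R_ring n = zpoly_ring ({X k |k. 1 \<le> k \<and> k \<le> n} \<union> {Q a b |a b. 1 \<le> a \<and> a < b \<and> b \<le> n})"

text \<open>Matrix entries are indexed from 0 here and in all matrices below, hence the shifts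
  by one.\<close>

definition M_mat :: "nat \<Rightarrow> xq zpoly mat" where
  "M_mat j = mat j j (\<lambda>(a, b).
     if a = b then xvar (a + 1)
     else if a < b then qvar (a + 1) (b + 1)
     else if a = b + 1 then - 1
     else 0)"

text \<open>\<open>char_poly (M_mat j)\<close> is \<open>det (t I - M j)\<close>.\<close>

definition E_poly :: "nat \<Rightarrow> nat \<Rightarrow> xq zpoly" where
  "E_poly i j = (if i \<le> j then (- 1) ^ i * coeff (char_poly (M_mat j)) (j - i) else 0)"

definition Q_ideal :: "nat \<Rightarrow> xq zpoly set" where
  "Q_ideal n = genideal (R_ring n) ((\<lambda>i. E_poly i n) ` {1..n})"

definition Q_ring :: "nat \<Rightarrow> xq zpoly set ring" where
  "Q_ring n = R_ring n Quot Q_ideal n"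

definition Q_class :: "nat \<Rightarrow> xq zpoly \<Rightarrow> xq zpoly set" where
  "Q_class n p = Q_ideal n +>\<^bsub>R_ring n\<^esub> p"


section \<open>Quantization\<close>

definition elem_sym :: "nat \<Rightarrow> nat \<Rightarrow> xq zpoly" where
  "elem_sym i j = (\<Sum>A | A \<subseteq> {1..j} \<and> card A = i. \<Prod>k\<in>A. xvar k)"

definition complete_sym :: "nat \<Rightarrow> nat \<Rightarrow> xq zpoly" where
  "complete_sym i j = (\<Sum>A | set_mset A \<subseteq> {1..j} \<and> size A = i. \<Prod>k\<in>#A. xvar k)"

text \<open>A sequence \<open>i\<^sub>1, \<dots>, i\<^sub>m\<close> up to trailing zeros is a finitely supported function;
  position 0 is unused, since the bound forces the value 0 there.\<close>

definition std_index :: "(nat \<Rightarrow>\<^sub>0 nat) set" where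
  "std_index = {I. \<forall>k. Poly_Mapping.lookup I k \<le> k}"

definition std_monomial :: "(nat \<Rightarrow> nat \<Rightarrow> xq zpoly) \<Rightarrow> (nat \<Rightarrow>\<^sub>0 nat) \<Rightarrow> xq zpoly" where
  "std_monomial g I = (\<Prod>k \<in> Poly_Mapping.keys I. g (Poly_Mapping.lookup I k) k)"

definition std_combination ::
  "(nat \<Rightarrow> nat \<Rightarrow> xq zpoly) \<Rightarrow> ((nat \<Rightarrow>\<^sub>0 nat) \<Rightarrow>\<^sub>0 int) \<Rightarrow> xq zpoly" where
  "std_combination g c =
    (\<Sum>I \<in> Poly_Mapping.keys c. of_int (Poly_Mapping.lookup c I) * std_monomial g I)"

text \<open>The coefficients of a polynomial in the \<open>x\<^sub>k\<close> (\<open>k \<ge> 1\<close>) with respect to the basis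
  of standard elementary monomials.\<close>

definition std_coeffs :: "xq zpoly \<Rightarrow> ((nat \<Rightarrow>\<^sub>0 nat) \<Rightarrow>\<^sub>0 int)" where
  "std_coeffs f = (THE c. Poly_Mapping.keys c \<subseteq> std_index \<and> f = std_combination elem_sym c)"

definition quantization :: "xq zpoly \<Rightarrow> xq zpoly" where
  "quantization f = std_combination E_poly (std_coeffs f)"

definition H_poly :: "nat \<Rightarrow> nat \<Rightarrow> xq zpoly" where
  "H_poly i j = quantization (complete_sym i j)"

definition f_poly :: "nat \<Rightarrow> nat \<Rightarrow> xq zpoly" where
  "f_poly i j = (\<Sum>k = 1..j. (\<Prod>l = j + 1..i. xvar k - xvar l) * xvar k)"

definition F_poly :: "nat \<Rightarrow> nat \<Rightarrow> xq zpoly" where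
  "F_poly i j = quantization (f_poly i j)"


section \<open>The coordinate ring of the unipotent group\<close>

text \<open>The pair \<open>(i, j)\<close> stands for the indeterminate \<open>z\<^sub>i\<^sub>j\<close>.\<close>

definition ZU_ring :: "nat \<Rightarrow> (nat \<times> nat) zpoly ring" where
  "ZU_ring n = zpoly_ring {(i, j). 1 \<le> j \<and> j < i \<and> i \<le> n}"

definition z_mat :: "nat \<Rightarrow> (nat \<times> nat) zpoly mat" where
  "z_mat n = mat n n (\<lambda>(a, b).
     if a = b then 1 else if b < a then var (a + 1, b + 1) else 0)"

definition z_inv :: "nat \<Rightarrow> (nat \<times> nat) zpoly mat" where
  "z_inv n = (THE w. w \<in> carrier_mat n n \<and> w * z_mat n = 1\<^sub>m n \<and> z_mat n * w = 1\<^sub>m n)"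

definition N_mat :: "nat \<Rightarrow> (nat \<times> nat) zpoly mat" where
  "N_mat n = mat n n (\<lambda>(a, b). if b = a + 1 then 1 else 0)"

definition S_mat :: "nat \<Rightarrow> (nat \<times> nat) zpoly mat" where
  "S_mat n = mat n n (\<lambda>(a, b). if a = b then of_nat (a + 1) else 0)"

definition nu :: "nat \<Rightarrow> nat \<Rightarrow> nat \<Rightarrow> (nat \<times> nat) zpoly" where
  "nu n i j = (z_inv n * N_mat n * z_mat n) $$ (i - 1, j - 1)"

definition xi :: "nat \<Rightarrow> nat \<Rightarrow> nat \<Rightarrow> (nat \<times> nat) zpoly" where
  "xi n i j = (z_inv n * S_mat n * z_mat n) $$ (i - 1, j - 1)"

end

theory Submission
  imports Defs "HOL-Computational_Algebra.Formal_Power_Series"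
begin

text \<open>Let \<open>A\<close> be the unitriangular matrix whose row \<open>r\<close> lists the coefficients of
  \<open>p\<^bsub>r-1\<^esub>(t) = det (t I - M\<^bsub>r-1\<^esub>)\<close>. Quantizing \<open>\<Sum>\<^sub>k (-1)\<^sup>k e\<^sub>k\<^bsup>(j+i-1)\<^esup> h\<^bsub>i-k\<^esub>\<^bsup>(j)\<^esup> = 0\<close>
  term by term, which is legitimate because \<open>h\<^bsub>i-k\<^esub>\<^bsup>(j)\<^esup>\<close> for \<open>k \<ge> 1\<close> only involves levels below
  \<open>j+i-1\<close>, shows that \<open>A\<close> is the inverse of the matrix of the \<open>H\<^bsub>i-j\<^esub>\<^bsup>(j)\<^esup>\<close>; so \<open>\<phi>\<close> sends
  \<open>z\<^sup>-\<^sup>1\<close> to \<open>A\<close>. Right multiplication of \<open>A\<close> by \<open>N\<close> is multiplication of the \<open>p\<^sub>r\<close> by \<open>t\<close> modulo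
  \<open>t\<^sup>n\<close>, and the expansion of the Hessenberg determinant \<open>p\<^sub>r\<close> along its last column expresses
  \<open>t p\<^bsub>r-1\<^esub>\<close> through \<open>p\<^sub>r, p\<^bsub>r-1\<^esub>, \<dots>, p\<^sub>0\<close> with coefficients \<open>\<plusminus>q\<^sub>a\<^sub>r\<close>, while \<open>p\<^sub>n = t\<^sup>n\<close> in \<open>Q\<^sub>n\<close>.
  The entries of \<open>A S z\<close> are quantizations of an identity for \<open>f\<^bsub>i-1,j\<^esub>\<close> obtained from generating
  functions.

  The standard elementary monomials are linearly independent: a combination of levels up to \<open>m\<close>
  that vanishes whenever distinct elements of a fixed set \<open>Y\<close> of size \<open>m+1\<close> are substituted is
  zero. For the induction, fix the set \<open>Y - {y}\<close> of values; then \<open>e\<^sub>i\<^bsup>(m)\<^esup>\<close> becomes the constant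
  \<open>e\<^sub>i(Y - {y})\<close>, and the remaining combination has levels up to \<open>m-1\<close>.\<close>

section \<open>Independence of the standard elementary monomials\<close>

text \<open>Index set and values are kept apart, so that this covers both the variables
  \<open>x_k\<close> and, with \<open>x\<close> the identity, finite sets of ring elements.\<close>

definition esym :: "('b \<Rightarrow> 'a::comm_ring_1) \<Rightarrow> nat \<Rightarrow> 'b set \<Rightarrow> 'a" where
  "esym x i T = (\<Sum>A | A \<subseteq> T \<and> card A = i. \<Prod>k\<in>A. x k)"

lemma elem_sym_eq_esym: "elem_sym i j = esym xvar i {1..j}"
  by (simp add: elem_sym_def esym_def)

lemma esym_0 [simp]: "finite T \<Longrightarrow> esym x 0 T = 1"
proof -
  assume "finite T"
  then have "{A. A \<subseteq> T \<and> card A = 0} = {{}}"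
    by (auto dest: finite_subset)
  then show ?thesis by (simp only: esym_def) simp
qed

text \<open>Sort the subsets by whether they contain \<open>y\<close>.\<close>

lemma esym_insert:
  assumes "finite T" "y \<notin> T"
  shows "esym x (Suc i) (insert y T) = esym x (Suc i) T + x y * esym x i T"
proof -
  let ?S = "\<lambda>i. {A. A \<subseteq> T \<and> card A = i}"
  have fin: "finite (?S i)" for i using assms(1) by simp
  have split: "{A. A \<subseteq> insert y T \<and> card A = Suc i} = ?S (Suc i) \<union> insert y ` ?S i"
  proof (intro Set.set_eqI iffI)
    fix A assume A: "A \<in> {A. A \<subseteq> insert y T \<and> card A = Suc i}"
    show "A \<in> ?S (Suc i) \<union> insert y ` ?S i"
    proof (cases "y \<in> A")
      case True
      then have "A - {y} \<in> ?S i" "A = insert y (A - {y})"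
        using A by (auto simp: card_Diff_singleton)
      then show ?thesis by blast
    next
      case False then show ?thesis using A by auto
    qed
  next
    fix A assume "A \<in> ?S (Suc i) \<union> insert y ` ?S i"
    then show "A \<in> {A. A \<subseteq> insert y T \<and> card A = Suc i}"
    proof
      assume "A \<in> insert y ` ?S i"
      then obtain B where "A = insert y B" "B \<subseteq> T" "card B = i" by auto
      moreover have "finite B" "y \<notin> B" using \<open>B \<subseteq> T\<close> assms finite_subset by auto
      ultimately show ?thesis by auto
    qed auto
  qed
  have disj: "?S (Suc i) \<inter> insert y ` ?S i = {}" using assms(2) by auto
  have inj: "inj_on (insert y) (?S i)"
  proof (rule inj_onI)
    fix A B assume "A \<in> ?S i" "B \<in> ?S i" and eq: "insert y A = insert y B"
    then have "y \<notin> A" "y \<notin> B" using assms(2) by auto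
    then show "A = B" using eq by (metis Diff_insert_absorb)
  qed
  have "esym x (Suc i) (insert y T) =
      (\<Sum>A\<in>?S (Suc i). \<Prod>k\<in>A. x k) + (\<Sum>A\<in>insert y ` ?S i. \<Prod>k\<in>A. x k)"
    unfolding esym_def split by (rule sum.union_disjoint[OF fin finite_imageI[OF fin] disj])
  also have "(\<Sum>A\<in>insert y ` ?S i. \<Prod>k\<in>A. x k) = (\<Sum>A\<in>?S i. \<Prod>k\<in>insert y A. x k)"
    by (subst sum.reindex[OF inj]) (simp add: comp_def)
  also have "\<dots> = x y * esym x i T"
    unfolding esym_def sum_distrib_left
  proof (rule sum.cong[OF refl])
    fix A assume "A \<in> ?S i"
    then have "finite A" "y \<notin> A" using assms finite_subset by auto
    then show "(\<Prod>k\<in>insert y A. x k) = x y * (\<Prod>k\<in>A. x k)" by simp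
  qed
  finally show ?thesis by (simp add: esym_def)
qed

text \<open>For distinct values only the set of values matters, which makes the top factor constant
  in the independence proof.\<close>

lemma esym_image:
  assumes "inj_on x T"
  shows "esym x i T = esym (\<lambda>y. y) i (x ` T)"
proof -
  let ?S = "{A. A \<subseteq> T \<and> card A = i}"
  have inj: "inj_on ((`) x) ?S"
  proof (rule inj_onI)
    fix A B assume "A \<in> ?S" "B \<in> ?S" "x ` A = x ` B"
    then show "A = B" using inj_on_image_eq_iff[OF assms, of A B] by simp
  qed
  have "{A. A \<subseteq> x ` T \<and> card A = i} = (`) x ` ?S"
  proof (intro Set.set_eqI iffI)
    fix A assume "A \<in> {A. A \<subseteq> x ` T \<and> card A = i}"
    then obtain B where B: "B \<subseteq> T" "A = x ` B" "card A = i"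
      by (auto simp: subset_image_iff)
    then have "card B = i" using card_image[OF inj_on_subset[OF assms B(1)]] by simp
    then show "A \<in> (`) x ` ?S" using B by auto
  next
    fix A assume "A \<in> (`) x ` ?S"
    then obtain B where B: "B \<subseteq> T" "A = x ` B" "card B = i" by auto
    then show "A \<in> {A. A \<subseteq> x ` T \<and> card A = i}"
      using card_image[OF inj_on_subset[OF assms B(1)]] by auto
  qed
  then have "esym (\<lambda>y. y) i (x ` T) = (\<Sum>A\<in>?S. \<Prod>k\<in>x ` A. k)"
    unfolding esym_def by (simp add: sum.reindex[OF inj])
  also have "\<dots> = esym x i T"
    unfolding esym_def
  proof (rule sum.cong[OF refl])
    fix A assume "A \<in> ?S"
    then have "inj_on x A" using assms inj_on_subset by auto
    then show "(\<Prod>k\<in>x ` A. k) = (\<Prod>k\<in>A. x k)" by (simp add: prod.reindex)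
  qed
  finally show ?thesis ..
qed

lemma esym_vanish: "finite T \<Longrightarrow> card T < i \<Longrightarrow> esym x i T = 0"
  by (auto simp: esym_def intro!: sum.neutral dest: card_mono)

text \<open>Subtracting the relations for \<open>y\<close> and \<open>y'\<close> yields a relation of the same shape for
  \<open>Y - {y'}\<close>, because \<open>e\<^sub>i(Y - {y}) - e\<^sub>i(Y - {y'}) = (y' - y) e\<^sub>i\<^sub>-\<^sub>1(Y - {y, y'})\<close>.\<close>

lemma esym_remove_independent:
  fixes c :: "nat \<Rightarrow> 'a::idom"
  assumes "finite Y" "card Y = Suc m"
    and "\<And>y. y \<in> Y \<Longrightarrow> (\<Sum>i\<le>m. c i * esym (\<lambda>y. y) i (Y - {y})) = 0"
    and "i \<le> m"
  shows "c i = 0"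
  using assms
proof (induction m arbitrary: Y c i)
  case 0
  then obtain y where "Y = {y}" by (auto simp: card_Suc_eq)
  then show ?case using 0(3)[of y] 0(4) by simp
next
  case (Suc m)
  obtain y' where y': "y' \<in> Y" using Suc.prems(2) by fastforce
  have card': "card (Y - {y'}) = Suc m" using y' Suc.prems by simp
  have pos: "c (Suc i) = 0" if "i \<le> m" for i
  proof (rule Suc.IH[of "Y - {y'}" "\<lambda>i. c (Suc i)"])
    fix y assume y: "y \<in> Y - {y'}"
    define T where "T = Y - {y'} - {y}"
    have T: "finite T" "y \<notin> T" "y' \<notin> T" "Y - {y'} = insert y T" "Y - {y} = insert y' T"
      using Suc.prems(1) y y' by (auto simp: T_def)
    have diff: "esym (\<lambda>y. y) (Suc i) (Y - {y}) - esym (\<lambda>y. y) (Suc i) (Y - {y'}) = (y' - y) * esym (\<lambda>y. y) i T" for i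
      unfolding T(4,5) using T(1-3) by (simp add: esym_insert algebra_simps)
    have "0 = (\<Sum>i\<le>Suc m. c i * esym (\<lambda>y. y) i (Y - {y})) - (\<Sum>i\<le>Suc m. c i * esym (\<lambda>y. y) i (Y - {y'}))"
      using Suc.prems(3)[of y] Suc.prems(3)[of y'] y y' by simp
    also have "\<dots> = (\<Sum>i\<le>m. c (Suc i) * (esym (\<lambda>y. y) (Suc i) (Y - {y}) - esym (\<lambda>y. y) (Suc i) (Y - {y'})))"
      unfolding sum.atMost_Suc_shift using Suc.prems(1)
      by (simp add: right_diff_distrib sum_subtractf)
    also have "\<dots> = (y' - y) * (\<Sum>i\<le>m. c (Suc i) * esym (\<lambda>y. y) i T)"
      unfolding diff sum_distrib_left by (simp add: mult.left_commute)
    \<comment> \<open>Since \<open>y\<close> differs from \<open>y'\<close>, the factor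
      \<open>y' - y\<close> cancels in the integral domain.\<close>
    finally show "(\<Sum>i\<le>m. c (Suc i) * esym (\<lambda>y. y) i (Y - {y'} - {y})) = 0"
      using y by (auto simp: T_def)
  qed (use Suc.prems(1) card' that in auto)
  have "c 0 = 0"
    using Suc.prems(3)[OF y'] Suc.prems(1) unfolding sum.atMost_Suc_shift
    by (simp add: pos)
  then show ?case using pos Suc.prems(4) by (cases i) auto
qed

text \<open>The standard monomials in levels 1 to \<open>m\<close> form a finite box, which allows
  induction on the number of levels.\<close>

definition bounded_index :: "nat \<Rightarrow> (nat \<Rightarrow>\<^sub>0 nat) set" where
  "bounded_index m = {I \<in> std_index. Poly_Mapping.keys I \<subseteq> {1..m}}"

lemma bounded_index_0: "bounded_index 0 = {0}"
  by (auto simp: bounded_index_def std_index_def)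

lemma lookup_bounded_index:
  "I \<in> bounded_index m \<Longrightarrow> k > m \<Longrightarrow> Poly_Mapping.lookup I k = 0"
  by (force simp: bounded_index_def in_keys_iff)

lemma bij_betw_bounded_index_Suc:
  "bij_betw (\<lambda>(I, i). I + Poly_Mapping.single (Suc m) i)
     (bounded_index m \<times> {..Suc m}) (bounded_index (Suc m))"
proof (rule bij_betw_byWitness[where f' =
    "\<lambda>I. (I - Poly_Mapping.single (Suc m) (Poly_Mapping.lookup I (Suc m)), Poly_Mapping.lookup I (Suc m))"],
    goal_cases)
  case 1
  show ?case
    by (auto simp: lookup_add lookup_bounded_index)
next
  case 2
  show ?case
    by (auto intro!: poly_mapping_eqI simp: lookup_add lookup_minus lookup_single when_def)
next
  case 3
  show ?case
  proof (rule image_subsetI)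
    fix p assume "p \<in> bounded_index m \<times> {..Suc m}"
    then obtain I i where p: "p = (I, i)" and I: "I \<in> bounded_index m" and i: "i \<in> {..Suc m}"
      by blast
    have "Poly_Mapping.lookup (I + Poly_Mapping.single (Suc m) i) k \<le> k" for k
      using I i lookup_bounded_index[OF I, of k]
      by (cases "k = Suc m") (auto simp: bounded_index_def std_index_def lookup_add lookup_single when_def)
    moreover have "Poly_Mapping.keys (I + Poly_Mapping.single (Suc m) i) \<subseteq> {1..Suc m}"
      using I by (intro order_trans[OF keys_add]) (auto simp: bounded_index_def split: if_splits)
    ultimately show "(case p of (I, i) \<Rightarrow> I + Poly_Mapping.single (Suc m) i) \<in> bounded_index (Suc m)"
      by (simp add: p bounded_index_def std_index_def)
  qed
next
  case 4
  show ?case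
  proof (rule image_subsetI)
    fix I assume I: "I \<in> bounded_index (Suc m)"
    let ?J = "I - Poly_Mapping.single (Suc m) (Poly_Mapping.lookup I (Suc m))"
    have J: "Poly_Mapping.lookup ?J k = (if k = Suc m then 0 else Poly_Mapping.lookup I k)" for k
      by (simp add: lookup_minus lookup_single when_def)
    have "Poly_Mapping.keys ?J = Poly_Mapping.keys I - {Suc m}"
      by (rule Set.set_eqI) (simp add: in_keys_iff J)
    moreover have "Poly_Mapping.keys I \<subseteq> {1..Suc m}"
      using I by (simp add: bounded_index_def)
    ultimately have "Poly_Mapping.keys ?J \<subseteq> {1..m}"
      by (auto simp only: atLeastAtMost_iff le_Suc_eq subset_iff Diff_iff singleton_iff)
    moreover have "Poly_Mapping.lookup ?J k \<le> k" for k
      using I by (simp add: J bounded_index_def std_index_def)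
    moreover have "Poly_Mapping.lookup I (Suc m) \<le> Suc m"
      using I unfolding bounded_index_def std_index_def by blast
    ultimately show "(?J, Poly_Mapping.lookup I (Suc m)) \<in> bounded_index m \<times> {..Suc m}"
      by (simp add: bounded_index_def std_index_def)
  qed
qed

lemma finite_bounded_index: "finite (bounded_index m)"
proof (induction m)
  case (Suc m)
  then show ?case using bij_betw_finite[OF bij_betw_bounded_index_Suc[of m]] by simp
qed (simp add: bounded_index_0)

text \<open>Substituting \<open>m\<close> of the \<open>m + 1\<close> values leaves one over.
  Varying the omitted value gives the equations for \<open>esym_remove_independent\<close>.\<close>

lemma esym_product_independent:
  fixes c :: "(nat \<Rightarrow>\<^sub>0 nat) \<Rightarrow> 'a::idom"
  assumes "finite Y" "card Y = Suc m"
    and "\<And>x. inj_on x {1..m} \<Longrightarrow> x ` {1..m} \<subseteq> Y \<Longrightarrow>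
      (\<Sum>I\<in>bounded_index m. c I * (\<Prod>k=1..m. esym (\<lambda>y. y) (Poly_Mapping.lookup I k) (x ` {1..k}))) = 0"
    and "I \<in> bounded_index m"
  shows "c I = 0"
  using assms
proof (induction m arbitrary: Y c I)
  case 0
  then show ?case by (simp add: bounded_index_0)
next
  case (Suc m)
  let ?e = "\<lambda>I i. I + Poly_Mapping.single (Suc m) i"
  have coeff0: "c (?e J i) = 0" if J: "J \<in> bounded_index m" and i: "i \<le> Suc m" for J i
  proof (rule esym_remove_independent[of Y "Suc m" "\<lambda>i. c (?e J i)"])
    fix y assume y: "y \<in> Y"
    let ?T = "Y - {y}"
    show "(\<Sum>i\<le>Suc m. c (?e J i) * esym (\<lambda>y. y) i ?T) = 0"
    proof (rule Suc.IH[of ?T "\<lambda>J. \<Sum>i\<le>Suc m. c (?e J i) * esym (\<lambda>y. y) i ?T"])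
      show "finite ?T" "card ?T = Suc m" using Suc.prems(1,2) y by auto
      fix x :: "nat \<Rightarrow> 'a" assume x: "inj_on x {1..m}" "x ` {1..m} \<subseteq> ?T"
      \<comment> \<open>\<open>x\<close> uses \<open>m\<close> of the \<open>m + 1\<close> elements
        of \<open>?T\<close>. Giving the last one to position \<open>m + 1\<close> turns the top
        factor into \<open>e_i(?T)\<close>, the same for every \<open>x\<close>.\<close>
      have "card (?T - x ` {1..m}) = 1"
        using \<open>finite ?T\<close> \<open>card ?T = Suc m\<close> x by (simp add: card_Diff_subset card_image)
      then obtain t where t: "?T - x ` {1..m} = {t}" by (auto simp: card_1_singleton_iff)
      define x' where "x' = x(Suc m := t)"
      have im: "x' ` {1..k} = x ` {1..k}" if "k \<le> m" for k
        using that by (auto simp: x'_def image_iff)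
      have "{1..Suc m} = insert (Suc m) {1..m}" by auto
      then have imT: "x' ` {1..Suc m} = ?T"
        using t x(2) im[of m] by (auto simp: x'_def)
      then have "inj_on x' {1..Suc m}"
        by (intro eq_card_imp_inj_on) (use \<open>card ?T = Suc m\<close> in auto)
      then have "0 = (\<Sum>I\<in>bounded_index (Suc m).
          c I * (\<Prod>k=1..Suc m. esym (\<lambda>y. y) (Poly_Mapping.lookup I k) (x' ` {1..k})))"
        by (intro Suc.prems(3)[symmetric] \<open>inj_on x' {1..Suc m}\<close>) (use imT in blast)
      also have "\<dots> = (\<Sum>(J, i)\<in>bounded_index m \<times> {..Suc m}.
          c (?e J i) * (\<Prod>k=1..Suc m. esym (\<lambda>y. y) (Poly_Mapping.lookup (?e J i) k) (x' ` {1..k})))"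
        by (subst sum.reindex_bij_betw[OF bij_betw_bounded_index_Suc, symmetric])
          (simp add: case_prod_unfold)
      also have "\<dots> = (\<Sum>(J, i)\<in>bounded_index m \<times> {..Suc m}.
          c (?e J i) * esym (\<lambda>y. y) i ?T * (\<Prod>k=1..m. esym (\<lambda>y. y) (Poly_Mapping.lookup J k) (x ` {1..k})))"
      proof (intro sum.cong refl, clarify)
        fix J i assume J: "J \<in> bounded_index m"
        have "(\<Prod>k=1..m. esym (\<lambda>y. y) (Poly_Mapping.lookup (?e J i) k) (x' ` {1..k})) =
            (\<Prod>k=1..m. esym (\<lambda>y. y) (Poly_Mapping.lookup J k) (x ` {1..k}))"
          by (intro prod.cong) (auto simp: lookup_add lookup_single im[unfolded One_nat_def])
        then show "c (?e J i) * (\<Prod>k=1..Suc m. esym (\<lambda>y. y) (Poly_Mapping.lookup (?e J i) k) (x' ` {1..k})) =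
            c (?e J i) * esym (\<lambda>y. y) i ?T * (\<Prod>k=1..m. esym (\<lambda>y. y) (Poly_Mapping.lookup J k) (x ` {1..k}))"
          using imT J by (simp add: lookup_add lookup_bounded_index mult_ac del: image_Suc_atLeastAtMost)
      qed
      also have "\<dots> = (\<Sum>J\<in>bounded_index m. (\<Sum>i\<le>Suc m. c (?e J i) * esym (\<lambda>y. y) i ?T) *
          (\<Prod>k=1..m. esym (\<lambda>y. y) (Poly_Mapping.lookup J k) (x ` {1..k})))"
        by (simp only: sum.cartesian_product[symmetric] sum_distrib_right)
      finally show "(\<Sum>J\<in>bounded_index m. (\<Sum>i\<le>Suc m. c (?e J i) * esym (\<lambda>y. y) i ?T) *
          (\<Prod>k=1..m. esym (\<lambda>y. y) (Poly_Mapping.lookup J k) (x ` {1..k}))) = 0" ..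
    qed (use J in simp)
  qed (use Suc.prems(1,2) i in auto)
  obtain J i where "J \<in> bounded_index m" "i \<le> Suc m" "I = ?e J i"
    using Suc.prems(4) bij_betw_imp_surj_on[OF bij_betw_bounded_index_Suc[of m]] by force
  then show ?case using coeff0 by simp
qed

section \<open>Evaluation of integral polynomials\<close>

lemma poly_mapping_eq_sum_single:
  "p = (\<Sum>a\<in>Poly_Mapping.keys p. Poly_Mapping.single a (Poly_Mapping.lookup p a))"
  by (rule poly_mapping_eqI) (simp add: lookup_sum lookup_single when_def in_keys_iff)

definition eval_monomial :: "('v \<Rightarrow> 'a::comm_ring_1) \<Rightarrow> ('v \<Rightarrow>\<^sub>0 nat) \<Rightarrow> 'a" where
  "eval_monomial f m = (\<Prod>v\<in>Poly_Mapping.keys m. f v ^ Poly_Mapping.lookup m v)"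

definition eval_zpoly :: "('v \<Rightarrow> 'a::comm_ring_1) \<Rightarrow> 'v zpoly \<Rightarrow> 'a" where
  "eval_zpoly f p = (\<Sum>m\<in>Poly_Mapping.keys p. of_int (Poly_Mapping.lookup p m) * eval_monomial f m)"

lemma eval_monomial_superset:
  "finite S \<Longrightarrow> Poly_Mapping.keys m \<subseteq> S \<Longrightarrow>
    eval_monomial f m = (\<Prod>v\<in>S. f v ^ Poly_Mapping.lookup m v)"
  unfolding eval_monomial_def by (rule prod.mono_neutral_left) (auto simp: in_keys_iff)

lemma eval_monomial_add: "eval_monomial f (a + b) = eval_monomial f a * eval_monomial f b"
  using eval_monomial_superset[of "Poly_Mapping.keys a \<union> Poly_Mapping.keys b" _ f] keys_add[of a b]
  by (simp add: lookup_add power_add prod.distrib)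

lemma eval_zpoly_superset:
  "finite S \<Longrightarrow> Poly_Mapping.keys p \<subseteq> S \<Longrightarrow>
    eval_zpoly f p = (\<Sum>m\<in>S. of_int (Poly_Mapping.lookup p m) * eval_monomial f m)"
  unfolding eval_zpoly_def by (rule sum.mono_neutral_left) (auto simp: in_keys_iff)

lemma eval_zpoly_add: "eval_zpoly f (p + q) = eval_zpoly f p + eval_zpoly f q"
  using eval_zpoly_superset[of "Poly_Mapping.keys p \<union> Poly_Mapping.keys q" _ f] keys_add[of p q]
  by (simp add: lookup_add ring_distribs sum.distrib)

lemma eval_zpoly_single: "eval_zpoly f (Poly_Mapping.single m c) = of_int c * eval_monomial f m"
  by (simp add: eval_zpoly_def)

lemma eval_zpoly_zero: "eval_zpoly f 0 = 0"
  by (simp add: eval_zpoly_def)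

lemma eval_zpoly_sum: "eval_zpoly f (\<Sum>i\<in>A. p i) = (\<Sum>i\<in>A. eval_zpoly f (p i))"
  by (induction A rule: infinite_finite_induct) (simp_all add: eval_zpoly_add eval_zpoly_zero)

lemma eval_zpoly_mult: "eval_zpoly f (p * q) = eval_zpoly f p * eval_zpoly f q"
proof -
  let ?s = "\<lambda>p a. Poly_Mapping.single a (Poly_Mapping.lookup p a)"
  have "p * q = (\<Sum>a\<in>Poly_Mapping.keys p. ?s p a) * (\<Sum>b\<in>Poly_Mapping.keys q. ?s q b)"
    using poly_mapping_eq_sum_single[of p] poly_mapping_eq_sum_single[of q] by simp
  also have "eval_zpoly f \<dots> = eval_zpoly f p * eval_zpoly f q"
    by (simp add: sum_product eval_zpoly_sum mult_single eval_zpoly_single eval_monomial_add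
        eval_zpoly_def[of f p] eval_zpoly_def[of f q] mult_ac)
  finally show ?thesis .
qed

lemma eval_zpoly_of_int:
  fixes f :: "'v \<Rightarrow> 'a::comm_ring_1"
  shows "eval_zpoly f (of_int c) = of_int c"
proof -
  have "of_int c = (Poly_Mapping.single 0 c :: 'v zpoly)"
    by (metis of_int_eq_id id_apply single_of_int)
  then show ?thesis by (simp add: eval_zpoly_single eval_monomial_def)
qed

lemma eval_zpoly_one: "eval_zpoly f 1 = 1"
  using eval_zpoly_of_int[of f 1] by simp

lemma eval_zpoly_prod: "eval_zpoly f (\<Prod>i\<in>A. p i) = (\<Prod>i\<in>A. eval_zpoly f (p i))"
  by (induction A rule: infinite_finite_induct) (simp_all add: eval_zpoly_mult eval_zpoly_one)

lemma eval_zpoly_var: "eval_zpoly f (var v) = f v"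
  by (simp add: var_def eval_zpoly_single eval_monomial_def)

lemma eval_zpoly_elem_sym: "eval_zpoly f (elem_sym i j) = esym (\<lambda>k. f (X k)) i {1..j}"
  by (simp add: elem_sym_def esym_def eval_zpoly_sum eval_zpoly_prod eval_zpoly_var)

section \<open>Linear combinations of standard monomials\<close>

lemma std_combination_superset:
  "finite S \<Longrightarrow> Poly_Mapping.keys c \<subseteq> S \<Longrightarrow>
    std_combination g c = (\<Sum>I\<in>S. of_int (Poly_Mapping.lookup c I) * std_monomial g I)"
  unfolding std_combination_def by (rule sum.mono_neutral_left) (auto simp: in_keys_iff)

lemma std_combination_zero [simp]: "std_combination g 0 = 0"
  by (simp add: std_combination_def)

lemma std_combination_single [simp]:
  "std_combination g (Poly_Mapping.single I a) = of_int a * std_monomial g I"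
  by (simp add: std_combination_def)

lemma std_combination_add:
  "std_combination g (c + d) = std_combination g c + std_combination g d"
  using std_combination_superset[of "Poly_Mapping.keys c \<union> Poly_Mapping.keys d" _ g] keys_add[of c d]
  by (simp add: lookup_add ring_distribs sum.distrib)

lemma std_combination_diff:
  "std_combination g (c - d) = std_combination g c - std_combination g d"
  using std_combination_superset[of "Poly_Mapping.keys c \<union> Poly_Mapping.keys d" _ g] keys_diff[of c d]
  by (simp add: lookup_minus ring_distribs sum_subtractf)

lemma std_combination_sum:
  "std_combination g (\<Sum>i\<in>A. c i) = (\<Sum>i\<in>A. std_combination g (c i))"
  by (induction A rule: infinite_finite_induct) (simp_all add: std_combination_add)

lemma std_monomial_superset:
  assumes "finite S" "Poly_Mapping.keys I \<subseteq> S" "\<And>k. k \<in> S \<Longrightarrow> g 0 k = 1"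
  shows "std_monomial g I = (\<Prod>k\<in>S. g (Poly_Mapping.lookup I k) k)"
  unfolding std_monomial_def using assms
  by (intro prod.mono_neutral_left) (auto simp: in_keys_iff)

lemma finite_subset_bounded_index:
  assumes "finite C" "C \<subseteq> std_index"
  shows "\<exists>m. C \<subseteq> bounded_index m"
proof -
  have "finite (\<Union>I\<in>C. Poly_Mapping.keys I)" using assms(1) by simp
  then obtain m where m: "\<And>I k. I \<in> C \<Longrightarrow> k \<in> Poly_Mapping.keys I \<Longrightarrow> k \<le> m"
    unfolding finite_nat_set_iff_bounded_le by blast
  have "I \<in> bounded_index m" if I: "I \<in> C" for I
  proof -
    have "I \<in> std_index" using I assms(2) by blast
    \<comment> \<open>The bound at position 0 forces the entry 0, so the support starts at
      1.\<close>
    then have "Poly_Mapping.lookup I 0 \<le> 0" unfolding std_index_def by blast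
    then have "k \<noteq> 0" if "k \<in> Poly_Mapping.keys I" for k
      using that by (metis in_keys_iff le_zero_eq)
    then have "Poly_Mapping.keys I \<subseteq> {1..m}" using m[OF I] by (auto simp: Suc_le_eq)
    then show ?thesis using I assms(2) by (auto simp: bounded_index_def)
  qed
  then show ?thesis by blast
qed

text \<open>Evaluation at distinct integers from \<open>{0..m}\<close>, with \<open>m\<close>
  bounding the levels in \<open>c\<close>, reduces this to
  \<open>esym_product_independent\<close>.\<close>

theorem std_monomials_independent:
  assumes "Poly_Mapping.keys c \<subseteq> std_index" "std_combination elem_sym c = 0"
  shows "c = 0"
proof (rule poly_mapping_eqI)
  fix I
  obtain m where m: "Poly_Mapping.keys c \<subseteq> bounded_index m"
    using finite_subset_bounded_index[OF finite_keys assms(1)] by blast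
  have "Poly_Mapping.lookup c I = 0" if I: "I \<in> bounded_index m"
  proof (rule esym_product_independent[of "int ` {..m}" m "Poly_Mapping.lookup c"])
    fix x :: "nat \<Rightarrow> int" assume x: "inj_on x {1..m}"
    \<comment> \<open>The value 0 at the \<open>q\<close> variables is a default;
      \<open>elem_sym\<close> contains only the \<open>x_k\<close>.\<close>
    define f where "f v = (case v of X k \<Rightarrow> x k | Q a b \<Rightarrow> 0)" for v
    have "eval_zpoly f (std_monomial elem_sym I) =
        (\<Prod>k=1..m. esym (\<lambda>y. y) (Poly_Mapping.lookup I k) (x ` {1..k}))"
      if "I \<in> bounded_index m" for I
    proof -
      have "std_monomial elem_sym I = (\<Prod>k=1..m. elem_sym (Poly_Mapping.lookup I k) k)"
        using that by (intro std_monomial_superset) (auto simp: bounded_index_def elem_sym_eq_esym)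
      then have "eval_zpoly f (std_monomial elem_sym I) =
          (\<Prod>k=1..m. esym x (Poly_Mapping.lookup I k) {1..k})"
        by (simp add: eval_zpoly_prod eval_zpoly_elem_sym f_def)
      also have "\<dots> = (\<Prod>k=1..m. esym (\<lambda>y. y) (Poly_Mapping.lookup I k) (x ` {1..k}))"
        by (intro prod.cong refl esym_image inj_on_subset[OF x]) auto
      finally show ?thesis .
    qed
    then have "(\<Sum>I\<in>bounded_index m. Poly_Mapping.lookup c I *
        (\<Prod>k=1..m. esym (\<lambda>y. y) (Poly_Mapping.lookup I k) (x ` {1..k}))) =
        eval_zpoly f (std_combination elem_sym c)"
      by (simp add: std_combination_superset[OF finite_bounded_index m] eval_zpoly_sum
          eval_zpoly_mult eval_zpoly_of_int)
    then show "(\<Sum>I\<in>bounded_index m. Poly_Mapping.lookup c I *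
        (\<Prod>k=1..m. esym (\<lambda>y. y) (Poly_Mapping.lookup I k) (x ` {1..k}))) = 0"
      using assms(2) by (simp add: eval_zpoly_zero)
  qed (use I in \<open>auto simp: card_image\<close>)
  then show "Poly_Mapping.lookup c I = Poly_Mapping.lookup 0 I"
    using m by (cases "I \<in> bounded_index m") (auto simp: in_keys_iff)
qed

section \<open>Quantization\<close>

lemma E_poly_0 [simp]: "E_poly 0 j = 1"
  using degree_monic_char_poly[of "M_mat j" j]
  by (simp add: E_poly_def M_mat_def)

text \<open>An explicit witness replaces the description in \<open>std_coeffs\<close>, and
  \<open>m\<close> records which levels are still free for a further factor.\<close>

definition quantizes :: "nat \<Rightarrow> xq zpoly \<Rightarrow> xq zpoly \<Rightarrow> bool" where
  "quantizes m f F \<longleftrightarrow> (\<exists>c. Poly_Mapping.keys c \<subseteq> bounded_index m \<and>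
     f = std_combination elem_sym c \<and> F = std_combination E_poly c)"

text \<open>By independence the witness is the expansion that \<open>std_coeffs\<close>
  selects.\<close>

lemma quantization_eqI:
  assumes "quantizes m f F"
  shows "quantization f = F"
proof -
  obtain c where c: "Poly_Mapping.keys c \<subseteq> bounded_index m"
    "f = std_combination elem_sym c" "F = std_combination E_poly c"
    using assms by (auto simp: quantizes_def)
  then have std: "Poly_Mapping.keys c \<subseteq> std_index" by (auto simp: bounded_index_def)
  have "std_coeffs f = c"
    unfolding std_coeffs_def
  proof (rule the_equality)
    fix d assume d: "Poly_Mapping.keys d \<subseteq> std_index \<and> f = std_combination elem_sym d"
    then have "Poly_Mapping.keys (d - c) \<subseteq> std_index"
      using keys_diff[of d c] std by blast
    moreover have "std_combination elem_sym (d - c) = 0"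
      using c(2) d by (simp add: std_combination_diff)
    ultimately have "d - c = 0" by (rule std_monomials_independent)
    then show "d = c" by simp
  qed (use std c(2) in blast)
  then show ?thesis using c(3) by (simp add: quantization_def)
qed

lemma bounded_index_mono: "m \<le> m' \<Longrightarrow> bounded_index m \<subseteq> bounded_index m'"
proof -
  assume "m \<le> m'"
  then have "{1..m} \<subseteq> {1..m'}" by simp
  then show ?thesis unfolding bounded_index_def by blast
qed

lemma quantizes_mono: "quantizes m f F \<Longrightarrow> m \<le> m' \<Longrightarrow> quantizes m' f F"
  unfolding quantizes_def by (metis bounded_index_mono subset_trans)

lemma quantizes_zero: "quantizes m 0 0"
  unfolding quantizes_def by (rule exI[of _ 0]) simp

lemma quantizes_one: "quantizes m 1 1"
  unfolding quantizes_def
  by (rule exI[of _ 1])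
    (simp add: bounded_index_def std_index_def std_monomial_def std_combination_def)

lemma quantizes_add:
  assumes "quantizes m f F" "quantizes m g G"
  shows "quantizes m (f + g) (F + G)"
proof -
  obtain c d where "Poly_Mapping.keys c \<subseteq> bounded_index m" "Poly_Mapping.keys d \<subseteq> bounded_index m"
    "f = std_combination elem_sym c" "F = std_combination E_poly c"
    "g = std_combination elem_sym d" "G = std_combination E_poly d"
    using assms by (auto simp: quantizes_def)
  then show ?thesis
    unfolding quantizes_def using keys_add[of c d]
    by (intro exI[of _ "c + d"]) (auto simp: std_combination_add)
qed

lemma quantizes_sum:
  "(\<And>i. i \<in> A \<Longrightarrow> quantizes m (f i) (F i)) \<Longrightarrow> quantizes m (\<Sum>i\<in>A. f i) (\<Sum>i\<in>A. F i)"
  by (induction A rule: infinite_finite_induct) (simp_all add: quantizes_zero quantizes_add)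

text \<open>Quantization is not multiplicative in general, but a factor at a level above all those
  in use only appends an entry to each index and so sends standard monomials to standard
  monomials.\<close>

lemma quantizes_mult:
  assumes "quantizes m f F" "i \<le> Suc m"
  shows "quantizes (Suc m) (of_int a * elem_sym i (Suc m) * f) (of_int a * E_poly i (Suc m) * F)"
proof -
  obtain c where c: "Poly_Mapping.keys c \<subseteq> bounded_index m"
    "f = std_combination elem_sym c" "F = std_combination E_poly c"
    using assms(1) by (auto simp: quantizes_def)
  let ?e = "\<lambda>I. I + Poly_Mapping.single (Suc m) i"
  have e: "?e I \<in> bounded_index (Suc m)" if "I \<in> bounded_index m" for I
    using bij_betw_imp_surj_on[OF bij_betw_bounded_index_Suc[of m]] that assms(2) by force
  have mono: "std_monomial g (?e I) = g i (Suc m) * std_monomial g I"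
    if I: "I \<in> bounded_index m" and g: "\<And>k. g 0 k = 1" for I g
  proof -
    have "std_monomial g (?e I) = (\<Prod>k=1..Suc m. g (Poly_Mapping.lookup (?e I) k) k)"
      using e[OF I] g by (intro std_monomial_superset) (auto simp: bounded_index_def)
    also have "\<dots> = g i (Suc m) * (\<Prod>k=1..m. g (Poly_Mapping.lookup I k) k)"
      using I by (simp add: lookup_add lookup_bounded_index lookup_single mult.commute)
    also have "(\<Prod>k=1..m. g (Poly_Mapping.lookup I k) k) = std_monomial g I"
      using I g by (intro std_monomial_superset[symmetric]) (auto simp: bounded_index_def)
    finally show ?thesis .
  qed
  define d where
    "d = (\<Sum>I\<in>Poly_Mapping.keys c. Poly_Mapping.single (?e I) (a * Poly_Mapping.lookup c I))"
  have "Poly_Mapping.keys d \<subseteq>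
      (\<Union>I\<in>Poly_Mapping.keys c. Poly_Mapping.keys (Poly_Mapping.single (?e I) (a * Poly_Mapping.lookup c I)))"
    unfolding d_def by (rule keys_sum)
  then have "Poly_Mapping.keys d \<subseteq> bounded_index (Suc m)"
    using e c(1) by (fastforce split: if_splits)
  moreover have "std_combination g d = of_int a * g i (Suc m) * std_combination g c"
    if "\<And>k. g 0 k = 1" for g
    unfolding d_def std_combination_sum std_combination_def[of g c] sum_distrib_left
    using c(1) that by (intro sum.cong refl) (auto simp: mono mult_ac)
  ultimately show ?thesis
    unfolding quantizes_def c(2,3)
    by (intro exI[of _ d]) (simp add: elem_sym_eq_esym)
qed

section \<open>Generating functions\<close>

lemma complete_sym_0 [simp]: "complete_sym 0 j = 1"
proof -
  have "{A. set_mset A \<subseteq> {1..j} \<and> size A = 0} = {{#}}" by auto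
  then show ?thesis unfolding complete_sym_def by simp
qed

lemma complete_sym_empty: "complete_sym i 0 = (if i = 0 then 1 else 0)"
proof -
  have "{A :: nat multiset. set_mset A \<subseteq> {1..0} \<and> size A = i} = (if i = 0 then {{#}} else {})"
    by auto
  then show ?thesis unfolding complete_sym_def by simp
qed

lemma finite_multisets_size: "finite A \<Longrightarrow> finite {M. set_mset M \<subseteq> A \<and> size M = i}"
proof -
  assume "finite A"
  then have "finite (mset ` {xs. set xs \<subseteq> A \<and> length xs = i})"
    by (intro finite_imageI finite_lists_length_eq)
  moreover have "{M. set_mset M \<subseteq> A \<and> size M = i} \<subseteq> mset ` {xs. set xs \<subseteq> A \<and> length xs = i}"
  proof
    fix M assume M: "M \<in> {M. set_mset M \<subseteq> A \<and> size M = i}"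
    obtain xs where "M = mset xs" by (metis ex_mset)
    then show "M \<in> mset ` {xs. set xs \<subseteq> A \<and> length xs = i}" using M by auto
  qed
  ultimately show ?thesis by (rule finite_subset[rotated])
qed

text \<open>Sort the multisets by whether they contain \<open>j + 1\<close>. Removing one copy may
  leave others, hence \<open>Suc j\<close> in the last factor.\<close>

lemma complete_sym_Suc:
  "complete_sym (Suc i) (Suc j) = complete_sym (Suc i) j + xvar (Suc j) * complete_sym i (Suc j)"
proof -
  let ?S = "\<lambda>i j. {M :: nat multiset. set_mset M \<subseteq> {1..j} \<and> size M = i}"
  let ?g = "\<lambda>M. \<Prod>k\<in>#M. xvar k"
  have fin: "finite (?S i j)" for i j by (rule finite_multisets_size) simp
  have eq: "?S (Suc i) (Suc j) = ?S (Suc i) j \<union> add_mset (Suc j) ` ?S i (Suc j)"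
  proof (intro Set.set_eqI iffI)
    fix M assume M: "M \<in> ?S (Suc i) (Suc j)"
    show "M \<in> ?S (Suc i) j \<union> add_mset (Suc j) ` ?S i (Suc j)"
    proof (cases "Suc j \<in># M")
      case True
      then obtain N where N: "M = add_mset (Suc j) N" by (metis multi_member_split)
      then have "N \<in> ?S i (Suc j)" using M by simp
      then show ?thesis using N by blast
    next
      case False
      then have "set_mset M \<subseteq> {1..j}" using M by (auto simp: atLeastAtMostSuc_conv)
      then show ?thesis using M by simp
    qed
  next
    fix M assume "M \<in> ?S (Suc i) j \<union> add_mset (Suc j) ` ?S i (Suc j)"
    then show "M \<in> ?S (Suc i) (Suc j)" by (auto simp: atLeastAtMostSuc_conv)
  qed
  have disj: "?S (Suc i) j \<inter> add_mset (Suc j) ` ?S i (Suc j) = {}" by auto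
  have inj: "inj_on (add_mset (Suc j)) (?S i (Suc j))" by (rule inj_onI) simp
  have "complete_sym (Suc i) (Suc j) = sum ?g (?S (Suc i) j) + sum ?g (add_mset (Suc j) ` ?S i (Suc j))"
    unfolding complete_sym_def eq by (rule sum.union_disjoint[OF fin finite_imageI[OF fin] disj])
  also have "sum ?g (add_mset (Suc j) ` ?S i (Suc j)) = (\<Sum>M\<in>?S i (Suc j). xvar (Suc j) * ?g M)"
    by (subst sum.reindex[OF inj]) (simp add: comp_def)
  finally show ?thesis by (simp add: complete_sym_def sum_distrib_left)
qed

lemma elem_sym_Suc:
  "elem_sym (Suc i) (Suc j) = elem_sym (Suc i) j + xvar (Suc j) * elem_sym i j"
  using esym_insert[of "{1..j}" "Suc j" xvar i]
  by (simp add: elem_sym_eq_esym atLeastAtMostSuc_conv)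

lemma elem_sym_0 [simp]: "elem_sym 0 j = 1"
  by (simp add: elem_sym_eq_esym)

definition lin_fps :: "'a::comm_ring_1 \<Rightarrow> 'a fps" where
  "lin_fps x = 1 - fps_const x * fps_X"

text \<open>The inverse of \<open>lin_fps x\<close>, given by coefficients because the ring need not
  be a field.\<close>

definition geo_fps :: "'a::comm_ring_1 \<Rightarrow> 'a fps" where
  "geo_fps x = Abs_fps (\<lambda>n. x ^ n)"

definition elem_fps :: "nat \<Rightarrow> xq zpoly fps" where
  "elem_fps m = Abs_fps (\<lambda>i. (- 1) ^ i * elem_sym i m)"

definition complete_fps :: "nat \<Rightarrow> xq zpoly fps" where
  "complete_fps j = Abs_fps (\<lambda>i. complete_sym i j)"

lemma lin_fps_mult_nth:
  "fps_nth (lin_fps x * f) n = fps_nth f n - (if n = 0 then 0 else x * fps_nth f (n - 1))"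
  by (simp add: lin_fps_def left_diff_distrib mult.assoc)

lemma lin_fps_geo_fps: "lin_fps x * geo_fps x = 1"
proof (rule fps_ext)
  show "fps_nth (lin_fps x * geo_fps x) n = fps_nth 1 n" for n
    by (cases n) (simp_all del: fps_mult_nth_0 add: lin_fps_mult_nth geo_fps_def)
qed

lemma elem_fps_eq_prod: "elem_fps m = (\<Prod>l=1..m. lin_fps (xvar l))"
proof (induction m)
  case 0
  have "elem_sym i 0 = 0" if "i > 0" for i
    using that by (simp add: elem_sym_eq_esym esym_vanish)
  then show ?case by (intro fps_ext) (auto simp: elem_fps_def)
next
  case (Suc m)
  have "elem_fps (Suc m) = lin_fps (xvar (Suc m)) * elem_fps m"
  proof (rule fps_ext)
    show "fps_nth (elem_fps (Suc m)) n = fps_nth (lin_fps (xvar (Suc m)) * elem_fps m) n" for n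
      by (cases n) (simp_all del: fps_mult_nth_0 add: lin_fps_mult_nth elem_fps_def elem_sym_Suc algebra_simps)
  qed
  then show ?case using Suc by (simp add: mult.commute)
qed

text \<open>By \<open>complete_sym_Suc\<close>, multiplying the left side by \<open>lin_fps\<close>
  removes the last variable; \<open>geo_fps\<close> inverts this.\<close>

lemma complete_fps_Suc: "complete_fps (Suc j) = geo_fps (xvar (Suc j)) * complete_fps j"
proof -
  have eq: "lin_fps (xvar (Suc j)) * complete_fps (Suc j) = complete_fps j"
  proof (rule fps_ext)
    show "fps_nth (lin_fps (xvar (Suc j)) * complete_fps (Suc j)) n = fps_nth (complete_fps j) n" for n
      by (cases n) (simp_all del: fps_mult_nth_0 add: lin_fps_mult_nth complete_fps_def complete_sym_Suc)
  qed
  have "geo_fps (xvar (Suc j)) * complete_fps j =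
      (lin_fps (xvar (Suc j)) * geo_fps (xvar (Suc j))) * complete_fps (Suc j)"
    by (simp only: eq[symmetric] mult_ac)
  then show ?thesis by (simp add: lin_fps_geo_fps)
qed

lemma prod_lin_fps_complete_fps: "(\<Prod>l=1..j. lin_fps (xvar l)) * complete_fps j = 1"
proof (induction j)
  case 0
  show ?case by (rule fps_ext) (simp add: complete_fps_def complete_sym_empty)
next
  case (Suc j)
  have "(\<Prod>l=1..Suc j. lin_fps (xvar l)) * complete_fps (Suc j) =
     (lin_fps (xvar (Suc j)) * geo_fps (xvar (Suc j))) * ((\<Prod>l=1..j. lin_fps (xvar l)) * complete_fps j)"
    by (simp add: complete_fps_Suc mult_ac)
  then show ?case using Suc by (simp add: lin_fps_geo_fps)
qed

lemma elem_fps_complete_fps: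
  assumes "j \<le> m"
  shows "elem_fps m * complete_fps j = (\<Prod>l=j+1..m. lin_fps (xvar l))"
proof -
  have "(\<Prod>l=1..m. lin_fps (xvar l)) = (\<Prod>l=1..j. lin_fps (xvar l)) * (\<Prod>l=j+1..m. lin_fps (xvar l))"
    using prod.ub_add_nat[of 1 j "\<lambda>l. lin_fps (xvar l)" "m - j"] assms by simp
  then have "elem_fps m * complete_fps j =
      ((\<Prod>l=1..j. lin_fps (xvar l)) * complete_fps j) * (\<Prod>l=j+1..m. lin_fps (xvar l))"
    unfolding elem_fps_eq_prod by (simp add: mult_ac)
  then show ?thesis by (simp only: prod_lin_fps_complete_fps mult_1)
qed

lemma prod_lin_fps_nth_eq_0:
  "finite L \<Longrightarrow> card L < n \<Longrightarrow> fps_nth (\<Prod>l\<in>L. lin_fps (y l)) n = 0"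
  by (induction L arbitrary: n rule: finite_induct) (auto simp: lin_fps_mult_nth)

text \<open>From degree \<open>card L\<close> on the coefficients are geometric with ratio
  \<open>x\<close>; a further factor \<open>1 - y u\<close> multiplies them by \<open>x - y\<close>
  and moves the start by one. This produces the products in \<open>f_poly\<close>.\<close>

lemma prod_lin_fps_geo_fps_nth:
  "finite L \<Longrightarrow> fps_nth ((\<Prod>l\<in>L. lin_fps (y l)) * geo_fps x) (card L + n) = x ^ n * (\<Prod>l\<in>L. x - y l)"
proof (induction L arbitrary: n rule: finite_induct)
  case empty
  show ?case by (simp add: geo_fps_def)
next
  case (insert l L)
  let ?F = "(\<Prod>l\<in>L. lin_fps (y l)) * geo_fps x"
  have "fps_nth ((\<Prod>l\<in>insert l L. lin_fps (y l)) * geo_fps x) (card (insert l L) + n) =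
      fps_nth (lin_fps (y l) * ?F) (card L + Suc n)"
    using insert.hyps by (simp add: mult.assoc)
  also have "\<dots> = fps_nth ?F (card L + Suc n) - y l * fps_nth ?F (card L + n)"
    by (simp add: lin_fps_mult_nth)
  also have "\<dots> = x ^ n * (\<Prod>l\<in>insert l L. x - y l)"
    unfolding insert.IH using insert.hyps by (simp add: algebra_simps)
  finally show ?case .
qed

text \<open>Differentiate \<open>lin_fps x * geo_fps x = 1\<close> and multiply by
  \<open>geo_fps x\<close>.\<close>

lemma fps_deriv_geo_fps: "fps_deriv (geo_fps x) = fps_const x * geo_fps x * geo_fps x"
proof -
  have "0 = geo_fps x * fps_deriv (lin_fps x * geo_fps x)"
    by (simp add: lin_fps_geo_fps)
  also have "\<dots> = (lin_fps x * geo_fps x) * fps_deriv (geo_fps x) - fps_const x * geo_fps x * geo_fps x"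
    by (simp add: lin_fps_def algebra_simps)
  finally show ?thesis by (simp add: lin_fps_geo_fps)
qed

text \<open>This is the logarithmic derivative of a product of geometric series.\<close>

lemma fps_deriv_complete_fps:
  "fps_deriv (complete_fps j) = complete_fps j * (\<Sum>k=1..j. fps_const (xvar k) * geo_fps (xvar k))"
proof (induction j)
  case 0
  have "complete_fps 0 = 1" by (rule fps_ext) (simp add: complete_fps_def complete_sym_empty)
  then show ?case by simp
next
  case (Suc j)
  then show ?case by (simp add: complete_fps_Suc fps_deriv_geo_fps algebra_simps)
qed

text \<open>At level \<open>j + i - 1\<close> the product in \<open>elem_fps_complete_fps\<close>
  has degree at most \<open>i - 1\<close>; no higher level gives such a bound.\<close>

lemma elem_complete_sum:
  assumes "i \<ge> 1" "j \<ge> 1"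
  shows "(\<Sum>k\<le>i. (- 1) ^ k * elem_sym k (j + i - 1) * complete_sym (i - k) j) = 0"
proof -
  have "fps_nth (elem_fps (j + i - 1) * complete_fps j) i = 0"
    using assms by (subst elem_fps_complete_fps) (auto intro!: prod_lin_fps_nth_eq_0)
  then show ?thesis
    by (simp add: fps_mult_nth elem_fps_def complete_fps_def atMost_atLeast0)
qed

text \<open>With \<open>P = \<Prod>\<^bsub>l\<le>m\<^esub> (1 - x\<^sub>l u)\<close> and \<open>H = \<Prod>\<^bsub>l\<le>j\<^esub> 1 / (1 - x\<^sub>l u)\<close>, the sum is the
  coefficient of \<open>u\<^bsup>m+1-j\<^esup>\<close> in \<open>P (j H + u H')\<close>; the summand \<open>j P H\<close> has degree \<open>m - j\<close>.\<close>

lemma f_poly_eq: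
  assumes "j \<ge> 1" "j \<le> m"
  shows "f_poly m j = (\<Sum>k\<le>m + 1 - j. (- 1) ^ k * of_nat (m + 1 - k) *
     elem_sym k m * complete_sym (m + 1 - j - k) j)"
proof -
  let ?L = "\<Prod>l=j+1..m. lin_fps (xvar l)"
  let ?W = "of_nat j * complete_fps j + fps_X * fps_deriv (complete_fps j)"
  \<comment> \<open>\<open>j + u d/du\<close> weights the coefficient of \<open>u^t\<close> by
    \<open>j + t\<close>. In the convolution \<open>t = m + 1 - j - k\<close>, so the weight is
    \<open>m + 1 - k\<close>, later a diagonal entry of \<open>S\<close>.\<close>
  have W: "fps_nth ?W t = of_nat (j + t) * complete_sym t j" for t
    by (cases t) (simp_all add: complete_fps_def algebra_simps flip: fps_of_nat)
  have "elem_fps m * ?W = of_nat j * ?L + (\<Sum>k=1..j. fps_const (xvar k) * (fps_X * (?L * geo_fps (xvar k))))"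
    unfolding fps_deriv_complete_fps elem_fps_complete_fps[OF assms(2), symmetric]
    by (simp add: distrib_left sum_distrib_left mult_ac)
  moreover have "fps_nth (of_nat j * ?L) (m + 1 - j) = 0"
    using assms by (simp add: prod_lin_fps_nth_eq_0 flip: fps_of_nat)
  moreover have "fps_nth (fps_const (xvar k) * (fps_X * (?L * geo_fps (xvar k)))) (m + 1 - j) =
     (\<Prod>l=j+1..m. xvar k - xvar l) * xvar k" for k
    using prod_lin_fps_geo_fps_nth[of "{j+1..m}" xvar "xvar k" 0] assms
    by (simp add: mult.commute)
  ultimately have "f_poly m j = fps_nth (elem_fps m * ?W) (m + 1 - j)"
    by (simp add: f_poly_def fps_sum_nth)
  also have "\<dots> = (\<Sum>k\<le>m + 1 - j. (- 1) ^ k * elem_sym k m *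
      (of_nat (j + (m + 1 - j - k)) * complete_sym (m + 1 - j - k) j))"
    unfolding fps_mult_nth W by (simp add: elem_fps_def atMost_atLeast0)
  also have "\<dots> = (\<Sum>k\<le>m + 1 - j. (- 1) ^ k * of_nat (m + 1 - k) *
     elem_sym k m * complete_sym (m + 1 - j - k) j)"
    using assms by (intro sum.cong refl) (simp add: mult_ac)
  finally show ?thesis .
qed

section \<open>Quantized identities\<close>

lemma complete_sym_rec:
  assumes "i \<ge> 1" "j \<ge> 1"
  shows "complete_sym i j =
    (\<Sum>k=1..i. of_int ((- 1) ^ Suc k) * elem_sym k (j + i - 1) * complete_sym (i - k) j)"
proof -
  have "{..i} = insert 0 {1..i}" by auto
  then have "complete_sym i j +
      (\<Sum>k=1..i. (- 1) ^ k * elem_sym k (j + i - 1) * complete_sym (i - k) j) = 0"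
    using elem_complete_sum[OF assms] by (simp del: One_nat_def)
  then have "complete_sym i j =
      - (\<Sum>k=1..i. (- 1) ^ k * elem_sym k (j + i - 1) * complete_sym (i - k) j)"
    by (rule add_eq_0_iff2[THEN iffD1])
  then show ?thesis by (simp add: sum_negf del: One_nat_def)
qed

lemma quantizes_complete_sym_rec:
  assumes "i \<ge> 1" "j \<ge> 1"
    and "\<And>k. k < i \<Longrightarrow> quantizes (j + k - 1) (complete_sym k j) (H k)"
  shows "quantizes (j + i - 1) (complete_sym i j)
    (\<Sum>k=1..i. of_int ((- 1) ^ Suc k) * E_poly k (j + i - 1) * H (i - k))"
  unfolding complete_sym_rec[OF assms(1,2)]
proof (rule quantizes_sum)
  fix k assume k: "k \<in> {1..i}"
  have "quantizes (j + (i - k) - 1) (complete_sym (i - k) j) (H (i - k))"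
    using k by (intro assms(3)) auto
  \<comment> \<open>As \<open>k\<close> is at least 1, level \<open>j + i - 1\<close> stays free for
    the factor \<open>elem_sym k\<close>.\<close>
  then have "quantizes (j + i - 2) (complete_sym (i - k) j) (H (i - k))"
    by (rule quantizes_mono) (use k in auto)
  moreover have "Suc (j + i - 2) = j + i - 1" "k \<le> j + i - 1" using assms(1,2) k by auto
  ultimately show "quantizes (j + i - 1)
      (of_int ((- 1) ^ Suc k) * elem_sym k (j + i - 1) * complete_sym (i - k) j)
      (of_int ((- 1) ^ Suc k) * E_poly k (j + i - 1) * H (i - k))"
    using quantizes_mult[of "j + i - 2" _ _ k] by metis
qed

text \<open>By strong induction the recursion supplies a standard expansion of
  \<open>h_i^(j)\<close>, which also computes \<open>H_poly i j\<close>.\<close>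

lemma quantizes_H_poly:
  assumes "j \<ge> 1"
  shows "quantizes (j + i - 1) (complete_sym i j) (H_poly i j)"
proof (induction i rule: less_induct)
  case (less i)
  show ?case
  proof (cases "i = 0")
    case True
    have "quantizes (j + i - 1) 1 1" by (rule quantizes_one)
    then show ?thesis using True quantization_eqI[of "j + i - 1" 1 1] by (simp add: H_poly_def)
  next
    case False
    then have q: "quantizes (j + i - 1) (complete_sym i j)
        (\<Sum>k=1..i. of_int ((- 1) ^ Suc k) * E_poly k (j + i - 1) * H_poly (i - k) j)"
        (is "quantizes _ _ ?R")
      using less by (intro quantizes_complete_sym_rec assms) auto
    have "H_poly i j = ?R" unfolding H_poly_def[of i] by (rule quantization_eqI[OF q])
    then show ?thesis using q by (simp only:)
  qed
qed

lemma H_poly_0 [simp]: "H_poly 0 j = 1"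
  using quantization_eqI[OF quantizes_one] by (simp add: H_poly_def)

lemma E_H_sum:
  assumes "i \<ge> 1" "j \<ge> 1"
  shows "(\<Sum>k\<le>i. (- 1) ^ k * E_poly k (j + i - 1) * H_poly (i - k) j) = 0"
proof -
  have "quantizes (j + i - 1) (complete_sym i j)
      (\<Sum>k=1..i. of_int ((- 1) ^ Suc k) * E_poly k (j + i - 1) * H_poly (i - k) j)"
    by (intro quantizes_complete_sym_rec assms quantizes_H_poly)
  then have "H_poly i j =
      (\<Sum>k=1..i. of_int ((- 1) ^ Suc k) * E_poly k (j + i - 1) * H_poly (i - k) j)"
    unfolding H_poly_def[of i] by (rule quantization_eqI)
  moreover have "{..i} = insert 0 {1..i}" by auto
  ultimately show ?thesis by (simp add: sum_negf)
qed

lemma F_poly_eq: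
  assumes "j \<ge> 1" "j \<le> m"
  shows "F_poly m j = (\<Sum>k\<le>m + 1 - j. (- 1) ^ k * of_nat (m + 1 - k) *
     E_poly k m * H_poly (m + 1 - j - k) j)"
  unfolding F_poly_def
proof (rule quantization_eqI)
  show "quantizes (Suc m) (f_poly m j) (\<Sum>k\<le>m + 1 - j. (- 1) ^ k * of_nat (m + 1 - k) *
     E_poly k m * H_poly (m + 1 - j - k) j)"
    unfolding f_poly_eq[OF assms]
  proof (rule quantizes_sum)
    fix k assume k: "k \<in> {..m + 1 - j}"
    define a where "a = (- 1) ^ k * int (m + 1 - k)"
    have a: "of_int a = ((- 1) ^ k * of_nat (m + 1 - k) :: xq zpoly)" by (simp add: a_def)
    have H: "quantizes (m - k) (complete_sym (m + 1 - j - k) j) (H_poly (m + 1 - j - k) j)"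
    proof -
      have "j + (m + 1 - j - k) - 1 = m - k" using k assms by auto
      then show ?thesis using quantizes_H_poly[OF assms(1), of "m + 1 - j - k"] by simp
    qed
    have "quantizes (Suc m) (of_int a * elem_sym k m * complete_sym (m + 1 - j - k) j)
      (of_int a * E_poly k m * H_poly (m + 1 - j - k) j)"
    proof (cases "k = 0")
      \<comment> \<open>Here \<open>h\<close> may reach level \<open>m\<close> itself. Since
        \<open>e_0 = 1\<close> at every level, that factor is taken at level
        \<open>m + 1\<close>.\<close>
      case True
      then show ?thesis using quantizes_mult[OF H, of 0 a] by simp
    next
      case False
      then have "m - k \<le> m - 1" "Suc (m - 1) = m" "k \<le> m" using k assms by auto
      then have "quantizes m (of_int a * elem_sym k m * complete_sym (m + 1 - j - k) j)
          (of_int a * E_poly k m * H_poly (m + 1 - j - k) j)"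
        using quantizes_mult[OF quantizes_mono[OF H], of "m - 1" k a] by simp
      then show ?thesis by (rule quantizes_mono) simp
    qed
    then show "quantizes (Suc m)
        ((- 1) ^ k * of_nat (m + 1 - k) * elem_sym k m * complete_sym (m + 1 - j - k) j)
        ((- 1) ^ k * of_nat (m + 1 - k) * E_poly k m * H_poly (m + 1 - j - k) j)"
      unfolding a .
  qed
qed

section \<open>Hessenberg determinants and the recursion for the characteristic polynomials\<close>

lemma det_mat_delete_hessenberg:
  fixes c :: "nat \<Rightarrow> nat \<Rightarrow> 'a::comm_ring_1"
  assumes sub: "\<And>i. c (Suc i) i = 1" and zero: "\<And>i j. Suc j < i \<Longrightarrow> c i j = 0"
  shows "a \<le> r \<Longrightarrow> det (mat_delete (mat (Suc r) (Suc r) (\<lambda>(i, j). c i j)) a r) =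
    det (mat a a (\<lambda>(i, j). c i j))"
proof (induction r)
  case 0
  then show ?case by (intro arg_cong[where f = det] eq_matI) (auto simp: mat_delete_def)
next
  case (Suc r)
  let ?C = "\<lambda>k. mat k k (\<lambda>(i, j). c i j)"
  show ?case
  proof (cases "a = Suc r")
    case True
    then have "mat_delete (?C (Suc (Suc r))) a (Suc r) = ?C a"
      by (intro eq_matI) (auto simp: mat_delete_def)
    then show ?thesis by simp
  next
    case False
    then have a: "a \<le> r" using Suc.prems by simp
    let ?D = "mat_delete (?C (Suc (Suc r))) a (Suc r)"
    have D: "?D \<in> carrier_mat (Suc r) (Suc r)" by (rule carrier_matI) simp_all
    \<comment> \<open>The deleted row \<open>a\<close> lies above, so this is row
      \<open>r + 1\<close> of the full matrix, where only the subdiagonal 1 precedes the last two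
      columns' diagonal entry.\<close>
    have row: "?D $$ (r, j) = (if j = r then 1 else 0)" if "j < Suc r" for j
      using that a sub zero by (auto simp: mat_delete_def)
    have "det ?D = (\<Sum>j<Suc r. ?D $$ (r, j) * cofactor ?D r j)"
      by (rule laplace_expansion_row[OF D]) simp
    also have "\<dots> = cofactor ?D r r"
      by (simp add: row)
    also have "\<dots> = det (mat_delete ?D r r)"
      by (simp add: cofactor_def flip: mult_2)
    also have "mat_delete ?D r r = mat_delete (?C (Suc r)) a r"
      using a by (intro eq_matI) (auto simp: mat_delete_def)
    finally show ?thesis using Suc.IH[OF a] by simp
  qed
qed

text \<open>In the expansion along the last column, the minor of row \<open>a\<close> is block
  triangular: the leading block of size \<open>a\<close> and a block with diagonal 1.\<close>

lemma det_hessenberg: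
  fixes c :: "nat \<Rightarrow> nat \<Rightarrow> 'a::comm_ring_1"
  assumes sub: "\<And>i. c (Suc i) i = 1" and zero: "\<And>i j. Suc j < i \<Longrightarrow> c i j = 0"
  shows "det (mat (Suc r) (Suc r) (\<lambda>(i, j). c i j)) =
    (\<Sum>a\<le>r. (- 1) ^ (a + r) * c a r * det (mat a a (\<lambda>(i, j). c i j)))"
proof -
  let ?C = "mat (Suc r) (Suc r) (\<lambda>(i, j). c i j)"
  have "det ?C = (\<Sum>a<Suc r. ?C $$ (a, r) * cofactor ?C a r)"
    by (rule laplace_expansion_column) auto
  also have "\<dots> = (\<Sum>a\<le>r. (- 1) ^ (a + r) * c a r * det (mat a a (\<lambda>(i, j). c i j)))"
    unfolding lessThan_Suc_atMost
    by (intro sum.cong refl) (simp add: cofactor_def det_mat_delete_hessenberg[of c, OF sub zero] mult_ac)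
  finally show ?thesis .
qed

text \<open>The entries -1 of \<open>M_mat\<close> become subdiagonal entries 1 of
  \<open>t I - M\<close>, so \<open>det_hessenberg\<close> applies; its term \<open>a = r\<close> is
  the linear factor.\<close>

lemma char_poly_M_mat_Suc:
  "char_poly (M_mat (Suc r)) = [:- xvar (Suc r), 1:] * char_poly (M_mat r) -
    (\<Sum>a<r. [:(- 1) ^ (a + r) * qvar (Suc a) (Suc r):] * char_poly (M_mat a))"
proof -
  define c :: "nat \<Rightarrow> nat \<Rightarrow> xq zpoly poly" where
    "c i j = (if i = j then [:- xvar (i + 1), 1:] else if i < j then [:- qvar (i + 1) (j + 1):]
      else if i = j + 1 then 1 else 0)" for i j
  have C: "char_poly (M_mat k) = det (mat k k (\<lambda>(i, j). c i j))" for k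
    unfolding char_poly_def
    by (intro arg_cong[where f = det] eq_matI) (auto simp: char_poly_matrix_def M_mat_def c_def one_pCons)
  have neg: "(- 1) ^ k * [:- q:] = - [:(- 1) ^ k * q:]" for k and q :: "xq zpoly"
    by (induction k) auto
  let ?D = "\<lambda>k. det (mat k k (\<lambda>(i, j). c i j))"
  have upper: "(- 1) ^ (a + r) * c a r * ?D a =
      - ([:(- 1) ^ (a + r) * qvar (Suc a) (Suc r):] * ?D a)" if "a < r" for a
  proof -
    have "c a r = [:- qvar (Suc a) (Suc r):]" using that by (simp add: c_def)
    then show ?thesis by (simp only: neg mult_minus_left)
  qed
  have "?D (Suc r) = (\<Sum>a\<le>r. (- 1) ^ (a + r) * c a r * ?D a)"
    by (rule det_hessenberg) (auto simp: c_def)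
  also have "\<dots> = c r r * ?D r + (\<Sum>a<r. (- 1) ^ (a + r) * c a r * ?D a)"
    by (simp add: add.commute flip: lessThan_Suc_atMost mult_2)
  also have "(\<Sum>a<r. (- 1) ^ (a + r) * c a r * ?D a) =
      - (\<Sum>a<r. [:(- 1) ^ (a + r) * qvar (Suc a) (Suc r):] * ?D a)"
    unfolding sum_negf[symmetric] by (intro sum.cong refl upper) simp
  also have "c r r = [:- xvar (Suc r), 1:]" by (simp add: c_def)
  finally show ?thesis unfolding C by (simp only: diff_conv_add_uminus)
qed

text \<open>The matrix \<open>A\<close> with rows counted from 0. Row \<open>n\<close>, just outside
  the matrix, is available for the last case of the recursion.\<close>

definition inv_coeff :: "nat \<Rightarrow> nat \<Rightarrow> xq zpoly" where
  "inv_coeff r s = coeff (char_poly (M_mat r)) s"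

lemma M_mat_carrier: "M_mat r \<in> carrier_mat r r"
  by (simp add: M_mat_def)

lemma inv_coeff_eq_E_poly: "s \<le> r \<Longrightarrow> inv_coeff r s = (- 1) ^ (r - s) * E_poly (r - s) r"
  by (simp add: inv_coeff_def E_poly_def flip: mult.assoc power_add)

lemma inv_coeff_eq_0: "r < s \<Longrightarrow> inv_coeff r s = 0"
  using degree_monic_char_poly[OF M_mat_carrier[of r]] by (simp add: inv_coeff_def coeff_eq_0)

lemma inv_coeff_diag: "inv_coeff r r = 1"
  using degree_monic_char_poly[OF M_mat_carrier[of r]] by (simp add: inv_coeff_def)

text \<open>Coefficients of \<open>t^s\<close> in \<open>char_poly_M_mat_Suc\<close>, solved for
  \<open>t p_r\<close>.\<close>

lemma inv_coeff_shift:
  "(if s = 0 then 0 else inv_coeff r (s - 1)) = inv_coeff (Suc r) s + xvar (Suc r) * inv_coeff r s +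
    (\<Sum>a<r. (- 1) ^ (a + r) * qvar (Suc a) (Suc r) * inv_coeff a s)"
  unfolding inv_coeff_def char_poly_M_mat_Suc
  by (cases s) (simp_all add: coeff_sum mult_pCons_left)

definition H_mat :: "nat \<Rightarrow> nat \<Rightarrow> xq zpoly" where
  "H_mat i j = (if j \<le> i then H_poly (i - j) (Suc j) else 0)"

text \<open>Below the diagonal this is \<open>E_H_sum\<close> with \<open>r - j\<close> and
  \<open>j + 1\<close> for \<open>i\<close> and \<open>j\<close>; its level is then
  \<open>r\<close>, that of row \<open>r\<close>.\<close>

lemma inv_coeff_H_mat:
  assumes "r < n"
  shows "(\<Sum>s<n. inv_coeff r s * H_mat s j) = (if r = j then 1 else 0)"
proof -
  have "(\<Sum>s<n. inv_coeff r s * H_mat s j) = (\<Sum>s\<in>{j..r}. inv_coeff r s * H_mat s j)"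
    using assms by (intro sum.mono_neutral_right) (auto simp: H_mat_def inv_coeff_eq_0)
  also have "\<dots> = (if r = j then 1 else 0)"
  proof (cases "r > j")
    case True
    have "(\<Sum>s\<in>{j..r}. inv_coeff r s * H_mat s j) =
        (\<Sum>k\<le>r - j. (- 1) ^ k * E_poly k (Suc j + (r - j) - 1) * H_poly (r - j - k) (Suc j))"
      using True
      by (intro sum.reindex_bij_witness[of _ "\<lambda>k. r - k" "\<lambda>s. r - s"])
        (auto simp: H_mat_def inv_coeff_eq_E_poly)
    also have "\<dots> = 0" using True by (intro E_H_sum) auto
    finally show ?thesis using True by simp
  next
    case False
    then show ?thesis by (cases "r = j") (auto simp: inv_coeff_diag H_mat_def)
  qed
  finally show ?thesis .
qed

text \<open>Putting \<open>s = r - k\<close> in \<open>F_poly_eq\<close> turns the weight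
  \<open>r + 1 - k\<close> into the diagonal entry \<open>s + 1\<close> of \<open>S\<close>.\<close>

lemma F_poly_eq_inv_coeff_sum:
  assumes "j < r" "r < n"
  shows "(\<Sum>s<n. inv_coeff r s * of_nat (Suc s) * H_mat s j) = F_poly r (Suc j)"
proof -
  have "(\<Sum>s<n. inv_coeff r s * of_nat (Suc s) * H_mat s j) =
      (\<Sum>s\<in>{j..r}. inv_coeff r s * of_nat (Suc s) * H_mat s j)"
    using assms by (intro sum.mono_neutral_right) (auto simp: H_mat_def inv_coeff_eq_0)
  also have "\<dots> = (\<Sum>k\<le>r + 1 - Suc j. (- 1) ^ k * of_nat (r + 1 - k) * E_poly k r *
      H_poly (r + 1 - Suc j - k) (Suc j))"
    using assms
    by (intro sum.reindex_bij_witness[of _ "\<lambda>k. r - k" "\<lambda>s. r - s"])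
      (auto simp: H_mat_def inv_coeff_eq_E_poly mult_ac)
  also have "\<dots> = F_poly r (Suc j)"
    using assms by (intro F_poly_eq[symmetric]) auto
  finally show ?thesis .
qed

section \<open>Passage to the quotient ring\<close>

lemma zpoly_ring_sel [simp]:
  "x \<otimes>\<^bsub>zpoly_ring V\<^esub> y = x * y" "x \<oplus>\<^bsub>zpoly_ring V\<^esub> y = x + y"
  "\<one>\<^bsub>zpoly_ring V\<^esub> = 1" "\<zero>\<^bsub>zpoly_ring V\<^esub> = 0"
  by (simp_all add: zpoly_ring_def)

lemma zpoly_ring_carrier_iff:
  "p \<in> carrier (zpoly_ring V) \<longleftrightarrow> (\<forall>m \<in> Poly_Mapping.keys p. Poly_Mapping.keys m \<subseteq> V)"
  by (simp add: zpoly_ring_def)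

lemma zpoly_ring_zero_closed: "0 \<in> carrier (zpoly_ring V)"
  and zpoly_ring_one_closed: "1 \<in> carrier (zpoly_ring V)"
  by (simp_all add: zpoly_ring_carrier_iff)

lemma zpoly_ring_add_closed:
  "p \<in> carrier (zpoly_ring V) \<Longrightarrow> q \<in> carrier (zpoly_ring V) \<Longrightarrow> p + q \<in> carrier (zpoly_ring V)"
  using keys_add[of p q] unfolding zpoly_ring_carrier_iff by blast

lemma zpoly_ring_uminus_closed:
  "p \<in> carrier (zpoly_ring V) \<Longrightarrow> - p \<in> carrier (zpoly_ring V)"
  by (simp add: zpoly_ring_carrier_iff)

lemma zpoly_ring_diff_closed:
  "p \<in> carrier (zpoly_ring V) \<Longrightarrow> q \<in> carrier (zpoly_ring V) \<Longrightarrow> p - q \<in> carrier (zpoly_ring V)"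
  using zpoly_ring_add_closed[of p V "- q"] zpoly_ring_uminus_closed[of q V] by simp

lemma zpoly_ring_mult_closed:
  assumes "p \<in> carrier (zpoly_ring V)" "q \<in> carrier (zpoly_ring V)"
  shows "p * q \<in> carrier (zpoly_ring V)"
  unfolding zpoly_ring_carrier_iff
proof
  fix m assume "m \<in> Poly_Mapping.keys (p * q)"
  then obtain a b where "m = a + b" "a \<in> Poly_Mapping.keys p" "b \<in> Poly_Mapping.keys q"
    using keys_mult[of p q] by blast
  then show "Poly_Mapping.keys m \<subseteq> V"
    using assms keys_add[of a b] unfolding zpoly_ring_carrier_iff by blast
qed

lemma zpoly_ring_sum_closed:
  "(\<And>i. i \<in> A \<Longrightarrow> p i \<in> carrier (zpoly_ring V)) \<Longrightarrow> (\<Sum>i\<in>A. p i) \<in> carrier (zpoly_ring V)"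
  by (induction A rule: infinite_finite_induct)
    (simp_all add: zpoly_ring_zero_closed zpoly_ring_add_closed)

lemma zpoly_ring_prod_closed:
  "(\<And>i. i \<in> A \<Longrightarrow> p i \<in> carrier (zpoly_ring V)) \<Longrightarrow> (\<Prod>i\<in>A. p i) \<in> carrier (zpoly_ring V)"
  by (induction A rule: infinite_finite_induct)
    (simp_all add: zpoly_ring_one_closed zpoly_ring_mult_closed)

lemma zpoly_ring_minus_one_power_closed: "(- 1) ^ k \<in> carrier (zpoly_ring V)"
  by (induction k) (simp_all add: zpoly_ring_one_closed zpoly_ring_uminus_closed)

lemma zpoly_ring_var_closed: "v \<in> V \<Longrightarrow> var v \<in> carrier (zpoly_ring V)"
  by (simp add: zpoly_ring_carrier_iff var_def)

lemma zpoly_ring_cring: "cring (zpoly_ring V)"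
proof (rule cringI)
  show "abelian_group (zpoly_ring V)"
  proof (rule abelian_groupI)
    fix x assume "x \<in> carrier (zpoly_ring V)"
    then show "\<exists>y\<in>carrier (zpoly_ring V). y \<oplus>\<^bsub>zpoly_ring V\<^esub> x = \<zero>\<^bsub>zpoly_ring V\<^esub>"
      by (intro bexI[of _ "- x"]) (simp_all add: zpoly_ring_uminus_closed)
  qed (simp_all add: zpoly_ring_zero_closed zpoly_ring_add_closed add_ac)
  show "comm_monoid (zpoly_ring V)"
    by (rule comm_monoidI) (simp_all add: zpoly_ring_one_closed zpoly_ring_mult_closed mult_ac)
qed (simp add: ring_distribs)

lemmas zpoly_ring_ring = cring.axioms(1)[OF zpoly_ring_cring]

section \<open>The inverse of \<open>z\<close>\<close>

lemma det_closed:
  assumes A: "A \<in> carrier_mat n n"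
    and "\<And>i j. i < n \<Longrightarrow> j < n \<Longrightarrow> A $$ (i, j) \<in> carrier (zpoly_ring V)"
  shows "det A \<in> carrier (zpoly_ring V)"
  unfolding det_def'[OF A]
proof (rule zpoly_ring_sum_closed)
  fix p assume p: "p \<in> {p. p permutes {0..<n}}"
  have "(\<Prod>i = 0..<n. A $$ (i, p i)) \<in> carrier (zpoly_ring V)"
    using p by (intro zpoly_ring_prod_closed assms(2)) (auto dest: permutes_in_image)
  moreover have "signof p \<in> carrier (zpoly_ring V)"
    by (simp add: sign_def zpoly_ring_one_closed zpoly_ring_uminus_closed)
  ultimately show "signof p * (\<Prod>i = 0..<n. A $$ (i, p i)) \<in> carrier (zpoly_ring V)"
    by (intro zpoly_ring_mult_closed)
qed

text \<open>Entries of the adjugate are signed minors. Closure matters because a homomorphism is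
  controlled only on the carrier.\<close>

lemma adj_mat_closed:
  assumes A: "A \<in> carrier_mat n n"
    and closed: "\<And>i j. i < n \<Longrightarrow> j < n \<Longrightarrow> A $$ (i, j) \<in> carrier (zpoly_ring V)"
    and ij: "i < n" "j < n"
  shows "adj_mat A $$ (i, j) \<in> carrier (zpoly_ring V)"
proof -
  have "det (mat_delete A j i) \<in> carrier (zpoly_ring V)"
  proof (rule det_closed)
    show "mat_delete A j i \<in> carrier_mat (n - 1) (n - 1)"
      using A by (rule mat_delete_carrier)
    fix a b assume "a < n - 1" "b < n - 1"
    then show "mat_delete A j i $$ (a, b) \<in> carrier (zpoly_ring V)"
      using A unfolding mat_delete_def by (auto intro!: closed)
  qed
  then show ?thesis
    using A ij
    by (simp add: adj_mat_def cofactor_def zpoly_ring_mult_closed zpoly_ring_minus_one_power_closed)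
qed

lemma det_z_mat: "det (z_mat n) = 1"
proof -
  have "det (z_mat n) = prod_list (diag_mat (z_mat n))"
    by (rule det_lower_triangular[of n]) (auto simp: z_mat_def)
  also have "diag_mat (z_mat n) = replicate n 1"
    by (rule nth_equalityI) (auto simp: diag_mat_def z_mat_def)
  finally show ?thesis by simp
qed

lemma z_mat_carrier: "z_mat n \<in> carrier_mat n n"
  by (simp add: z_mat_def)

text \<open>The determinant is 1, so the adjugate is an inverse without any division.\<close>

lemma z_mat_adj_mat:
  "adj_mat (z_mat n) \<in> carrier_mat n n"
  "adj_mat (z_mat n) * z_mat n = 1\<^sub>m n" "z_mat n * adj_mat (z_mat n) = 1\<^sub>m n"
proof -
  have "1 \<cdot>\<^sub>m 1\<^sub>m n = (1\<^sub>m n :: (nat \<times> nat) zpoly mat)" by (rule eq_matI) auto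
  then show "adj_mat (z_mat n) \<in> carrier_mat n n"
    "adj_mat (z_mat n) * z_mat n = 1\<^sub>m n" "z_mat n * adj_mat (z_mat n) = 1\<^sub>m n"
    using adj_mat[OF z_mat_carrier[of n]] by (simp_all add: det_z_mat)
qed

lemma z_inv_eq_adj_mat: "z_inv n = adj_mat (z_mat n)"
  unfolding z_inv_def
proof (rule the_equality)
  let ?w = "adj_mat (z_mat n)"
  show w: "?w \<in> carrier_mat n n \<and> ?w * z_mat n = 1\<^sub>m n \<and> z_mat n * ?w = 1\<^sub>m n"
    by (simp add: z_mat_adj_mat)
  fix w' assume w': "w' \<in> carrier_mat n n \<and> w' * z_mat n = 1\<^sub>m n \<and> z_mat n * w' = 1\<^sub>m n"
  have "w' = w' * (z_mat n * ?w)" using w w' right_mult_one_mat[of w' n n] by simp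
  also have "\<dots> = (w' * z_mat n) * ?w"
    using w w' z_mat_carrier[of n] by (intro assoc_mult_mat[symmetric]) auto
  also have "\<dots> = ?w" using w w' left_mult_one_mat[of ?w n n] by simp
  finally show "w' = ?w" .
qed

lemma z_inv_carrier: "z_inv n \<in> carrier_mat n n"
  and z_mat_z_inv: "z_mat n * z_inv n = 1\<^sub>m n"
  by (simp_all add: z_inv_eq_adj_mat z_mat_adj_mat)

lemma mat_mult_index_sum:
  "A \<in> carrier_mat n n \<Longrightarrow> B \<in> carrier_mat n n \<Longrightarrow> i < n \<Longrightarrow> j < n \<Longrightarrow>
    (A * B) $$ (i, j) = (\<Sum>k<n. A $$ (i, k) * B $$ (k, j))"
  by (simp add: scalar_prod_def atLeast0LessThan)

text \<open>\<open>rel p r\<close> expresses that \<open>r\<close> is a representative of \<open>f p\<close> along \<open>g\<close>; with \<open>f = g\<close> it is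
  congruence modulo the kernel.\<close>

locale zpoly_hom_pair =
  fixes V :: "'v set" and W :: "'w set" and S :: "('s, 't) ring_scheme" (structure) and f g
  assumes ring_S: "ring S"
    and f_hom: "f \<in> Ring.ring_hom (zpoly_ring V) S"
    and g_hom: "g \<in> Ring.ring_hom (zpoly_ring W) S"
begin

definition rel :: "'v zpoly \<Rightarrow> 'w zpoly \<Rightarrow> bool" where
  "rel p r \<longleftrightarrow> p \<in> carrier (zpoly_ring V) \<and> r \<in> carrier (zpoly_ring W) \<and> f p = g r"

lemma rel_zero: "rel 0 0"
  using ring_hom_zero[OF f_hom zpoly_ring_ring ring_S] ring_hom_zero[OF g_hom zpoly_ring_ring ring_S]
  by (simp add: rel_def zpoly_ring_zero_closed)

lemma rel_one: "rel 1 1"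
  using ring_hom_one[OF f_hom] ring_hom_one[OF g_hom]
  by (simp add: rel_def zpoly_ring_one_closed)

lemma rel_add: "rel p r \<Longrightarrow> rel q s \<Longrightarrow> rel (p + q) (r + s)"
  using ring_hom_add[OF f_hom, of p q] ring_hom_add[OF g_hom, of r s]
  by (simp add: rel_def zpoly_ring_add_closed)

lemma rel_mult: "rel p r \<Longrightarrow> rel q s \<Longrightarrow> rel (p * q) (r * s)"
  using ring_hom_mult[OF f_hom, of p q] ring_hom_mult[OF g_hom, of r s]
  by (simp add: rel_def zpoly_ring_mult_closed)

lemma rel_sum: "(\<And>i. i \<in> A \<Longrightarrow> rel (p i) (r i)) \<Longrightarrow> rel (\<Sum>i\<in>A. p i) (\<Sum>i\<in>A. r i)"
  by (induction A rule: infinite_finite_induct) (simp_all add: rel_zero rel_add)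

lemma rel_of_nat: "rel (of_nat k) (of_nat k)"
  by (induction k) (simp_all add: rel_zero rel_one rel_add)

end

section \<open>Membership in \<open>R_n\<close> and reduction modulo the ideal\<close>

definition xq_vars :: "nat \<Rightarrow> xq set" where
  "xq_vars n = {X k |k. 1 \<le> k \<and> k \<le> n} \<union> {Q a b |a b. 1 \<le> a \<and> a < b \<and> b \<le> n}"

definition z_vars :: "nat \<Rightarrow> (nat \<times> nat) set" where
  "z_vars n = {(i, j). 1 \<le> j \<and> j < i \<and> i \<le> n}"

lemma R_ring_eq: "R_ring n = zpoly_ring (xq_vars n)"
  by (simp add: R_ring_def xq_vars_def)

lemma ZU_ring_eq: "ZU_ring n = zpoly_ring (z_vars n)"
  by (simp add: ZU_ring_def z_vars_def)

lemma inv_coeff_closed: "r \<le> n \<Longrightarrow> inv_coeff r s \<in> carrier (zpoly_ring (xq_vars n))"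
proof (induction r arbitrary: s rule: less_induct)
  case (less r)
  show ?case
  proof (cases r)
    case 0
    then show ?thesis
      by (cases "s = 0") (simp_all add: inv_coeff_diag inv_coeff_eq_0 zpoly_ring_zero_closed zpoly_ring_one_closed)
  next
    case (Suc r')
    have IH: "inv_coeff a t \<in> carrier (zpoly_ring (xq_vars n))" if "a \<le> r'" for a t
      using less that Suc by simp
    have "xvar (Suc r') \<in> carrier (zpoly_ring (xq_vars n))"
      using less.prems Suc by (intro zpoly_ring_var_closed) (simp add: xq_vars_def)
    moreover have "qvar (Suc a) (Suc r') \<in> carrier (zpoly_ring (xq_vars n))" if "a < r'" for a
      using that less.prems Suc by (intro zpoly_ring_var_closed) (simp add: xq_vars_def)
    moreover have "inv_coeff (Suc r') s = (if s = 0 then 0 else inv_coeff r' (s - 1)) -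
        xvar (Suc r') * inv_coeff r' s -
        (\<Sum>a<r'. (- 1) ^ (a + r') * qvar (Suc a) (Suc r') * inv_coeff a s)"
      unfolding inv_coeff_shift by simp
    ultimately show ?thesis
      unfolding Suc using IH
      by (auto intro!: zpoly_ring_diff_closed zpoly_ring_uminus_closed zpoly_ring_mult_closed zpoly_ring_sum_closed
          zpoly_ring_minus_one_power_closed zpoly_ring_zero_closed)
  qed
qed

text \<open>As \<open>A\<close> has unit diagonal, row \<open>i\<close> of \<open>A H = 1\<close>
  expresses \<open>H_mat i j\<close> through earlier rows, without unfolding the
  quantization.\<close>

lemma H_mat_closed: "i < n \<Longrightarrow> H_mat i j \<in> carrier (zpoly_ring (xq_vars n))"
proof (induction i rule: less_induct)
  case (less i)
  have "H_mat i j = (if i = j then 1 else 0) - (\<Sum>s<i. inv_coeff i s * H_mat s j)"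
    using inv_coeff_H_mat[of i "Suc i" j] by (simp add: inv_coeff_diag eq_diff_eq add.commute)
  moreover have "(\<Sum>s<i. inv_coeff i s * H_mat s j) \<in> carrier (zpoly_ring (xq_vars n))"
    using less by (intro zpoly_ring_sum_closed zpoly_ring_mult_closed inv_coeff_closed) auto
  ultimately show ?case
    by (simp add: zpoly_ring_diff_closed zpoly_ring_one_closed zpoly_ring_zero_closed)
qed

lemma E_poly_closed: "i \<le> n \<Longrightarrow> E_poly i n \<in> carrier (R_ring n)"
  by (simp add: E_poly_def R_ring_eq zpoly_ring_mult_closed zpoly_ring_minus_one_power_closed
      inv_coeff_closed flip: inv_coeff_def)

lemma Q_ideal_ideal: "ideal (Q_ideal n) (R_ring n)"
proof -
  have "ring (R_ring n)" unfolding R_ring_eq by (rule zpoly_ring_ring)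
  then show ?thesis
    unfolding Q_ideal_def by (rule ring.genideal_ideal) (auto intro: E_poly_closed)
qed

lemma Q_class_hom: "Q_class n \<in> Ring.ring_hom (R_ring n) (Q_ring n)"
  using ideal.rcos_ring_hom[OF Q_ideal_ideal[of n]]
  by (simp add: Q_ring_def Q_class_def[abs_def])

lemma Q_ring_ring: "ring (Q_ring n)"
  using ideal.quotient_is_ring[OF Q_ideal_ideal] by (simp add: Q_ring_def)

lemma Q_class_surj:
  assumes "c \<in> carrier (Q_ring n)"
  obtains r where "r \<in> carrier (R_ring n)" "c = Q_class n r"
  using assms by (auto simp: Q_ring_def FactRing_def A_RCOSETS_def' Q_class_def)

lemma Q_class_eq_zero:
  assumes "p \<in> Q_ideal n"
  shows "Q_class n p = Q_class n 0"
proof -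
  interpret ideal "Q_ideal n" "R_ring n" by (rule Q_ideal_ideal)
  have "0 \<in> Q_ideal n"
    using additive_subgroup.zero_closed[OF additive_subgroup_axioms] by (simp add: R_ring_eq)
  then show ?thesis
    using assms a_rcos_const by (simp add: Q_class_def)
qed

text \<open>This is \<open>p_n = t^n\<close> in \<open>Q_n\<close>, read coefficientwise: the lower
  coefficients are signed generators.\<close>

lemma inv_coeff_n_in_Q_ideal:
  assumes "s < n"
  shows "inv_coeff n s \<in> Q_ideal n"
proof -
  interpret ideal "Q_ideal n" "R_ring n" by (rule Q_ideal_ideal)
  have "(\<lambda>i. E_poly i n) ` {1..n} \<subseteq> Q_ideal n"
    unfolding Q_ideal_def
    by (rule genideal_self) (auto intro: E_poly_closed)
  then have "E_poly (n - s) n \<in> Q_ideal n" using assms by auto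
  then have "(- 1) ^ (n - s) \<otimes>\<^bsub>R_ring n\<^esub> E_poly (n - s) n \<in> Q_ideal n"
    by (rule I_l_closed) (simp add: R_ring_eq zpoly_ring_minus_one_power_closed)
  then show ?thesis using assms by (simp add: inv_coeff_eq_E_poly R_ring_eq)
qed

lemma z_mat_index_closed:
  "i < n \<Longrightarrow> j < n \<Longrightarrow> z_mat n $$ (i, j) \<in> carrier (ZU_ring n)"
  by (auto simp: z_mat_def ZU_ring_eq z_vars_def zpoly_ring_zero_closed zpoly_ring_one_closed
      intro!: zpoly_ring_var_closed)

lemma z_inv_index_closed:
  "i < n \<Longrightarrow> j < n \<Longrightarrow> z_inv n $$ (i, j) \<in> carrier (ZU_ring n)"
  unfolding z_inv_eq_adj_mat ZU_ring_eq
  by (rule adj_mat_closed[OF z_mat_carrier]) (auto simp: z_mat_index_closed simp flip: ZU_ring_eq)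

text \<open>Right multiplication of a row by \<open>N\<close>, that is, multiplication by
  \<open>t\<close> modulo \<open>t^n\<close>.\<close>

lemma sum_shift_row:
  "k < n \<Longrightarrow> (\<Sum>l<n. A l * (if k = Suc l then 1 else 0)) =
    (if k = 0 then 0 else A (k - 1) :: 'a::comm_semiring_1)"
proof (cases k)
  case (Suc k')
  assume "k < n"
  then show ?thesis using Suc by (subst sum.remove[of _ k']) auto
qed simp

section \<open>The images of \<open>nu\<close> and \<open>xi\<close>\<close>

theorem theorem1p2:
  fixes n :: nat
    and \<phi> :: "(nat \<times> nat) zpoly \<Rightarrow> xq zpoly set"
  assumes "n \<ge> 1"
    and "\<phi> \<in> Ring.ring_hom (ZU_ring n) (Q_ring n)"
    and "\<And>i j. 1 \<le> j \<Longrightarrow> j < i \<Longrightarrow> i \<le> n \<Longrightarrow> \<phi> (var (i, j)) = Q_class n (H_poly (i - j) j)"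
  shows "\<forall>i j. 1 \<le> j \<and> j < i \<and> i \<le> n \<longrightarrow>
      \<phi> (nu n i j) = Q_class n ((- 1) ^ (i - j) * qvar j i) \<and>
      \<phi> (xi n i j) = Q_class n (F_poly (i - 1) j)"
proof -
  let ?C = "carrier (R_ring n)"
  \<comment> \<open>\<open>L\<close> relates a polynomial in the \<open>z\<close> to representatives
    of its image; \<open>K\<close> is congruence modulo the ideal.\<close>
  interpret L: zpoly_hom_pair "z_vars n" "xq_vars n" "Q_ring n" \<phi> "Q_class n"
    using assms(2) Q_class_hom[of n] Q_ring_ring[of n]
    by (intro zpoly_hom_pair.intro) (simp_all add: R_ring_eq ZU_ring_eq)
  interpret K: zpoly_hom_pair "xq_vars n" "xq_vars n" "Q_ring n" "Q_class n" "Q_class n"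
    using Q_class_hom[of n] Q_ring_ring[of n] by (intro zpoly_hom_pair.intro) (simp_all add: R_ring_eq)
  have K_refl: "K.rel p p" if "p \<in> ?C" for p
    using that by (simp add: K.rel_def R_ring_eq)
  have L_K: "K.rel r s" if "L.rel p r" "L.rel p s" for p r s
    using that by (simp add: K.rel_def L.rel_def)
  have L_trans: "L.rel p s" if "L.rel p r" "K.rel r s" for p r s
    using that by (simp add: K.rel_def L.rel_def)
  have inv_coeff_C: "inv_coeff r s \<in> ?C" if "r \<le> n" for r s
    using inv_coeff_closed[OF that] by (simp add: R_ring_eq)
  have H_C: "H_mat i j \<in> ?C" if "i < n" for i j
    using H_mat_closed[OF that] by (simp add: R_ring_eq)

  have z: "L.rel (z_mat n $$ (i, j)) (H_mat i j)" if ij: "i < n" "j < n" for i j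
  proof -
    consider "i < j" | "i = j" | "j < i" by linarith
    then show ?thesis
    proof cases
      case 3
      then have "\<phi> (z_mat n $$ (i, j)) = Q_class n (H_mat i j)"
        using ij assms(3)[of "Suc j" "Suc i"] by (simp add: z_mat_def H_mat_def)
      then show ?thesis
        using z_mat_index_closed[OF ij] H_C[OF ij(1)] by (simp add: L.rel_def R_ring_eq ZU_ring_eq)
    qed (use ij L.rel_zero L.rel_one in \<open>simp_all add: z_mat_def H_mat_def\<close>)
  qed

  \<comment> \<open>The images of the entries of \<open>z_inv n\<close> first get arbitrary
    representatives \<open>W\<close>, which are then identified with \<open>A\<close> modulo the
    ideal.\<close>
  have "\<forall>i j. \<exists>r. i < n \<longrightarrow> j < n \<longrightarrow> L.rel (z_inv n $$ (i, j)) r"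
  proof (intro allI)
    fix i j
    show "\<exists>r. i < n \<longrightarrow> j < n \<longrightarrow> L.rel (z_inv n $$ (i, j)) r"
    proof (cases "i < n \<and> j < n")
      case True
      then have closed: "z_inv n $$ (i, j) \<in> carrier (ZU_ring n)" by (simp add: z_inv_index_closed)
      then have "\<phi> (z_inv n $$ (i, j)) \<in> carrier (Q_ring n)" by (rule ring_hom_closed[OF assms(2)])
      then obtain r where "r \<in> ?C" "\<phi> (z_inv n $$ (i, j)) = Q_class n r" by (rule Q_class_surj)
      then show ?thesis using closed by (auto simp: L.rel_def R_ring_eq ZU_ring_eq)
    qed auto
  qed
  then obtain W where W: "\<And>i j. i < n \<Longrightarrow> j < n \<Longrightarrow> L.rel (z_inv n $$ (i, j)) (W i j)"
    by metis

  have HW: "K.rel (\<Sum>k<n. H_mat i k * W k j) (if i = j then 1 else 0)" if ij: "i < n" "j < n" for i j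
  proof (rule L_K)
    show "L.rel (\<Sum>k<n. z_mat n $$ (i, k) * z_inv n $$ (k, j)) (\<Sum>k<n. H_mat i k * W k j)"
      by (intro L.rel_sum L.rel_mult z W ij) auto
    have "(\<Sum>k<n. z_mat n $$ (i, k) * z_inv n $$ (k, j)) = (if i = j then 1 else 0)"
      using mat_mult_index_sum[OF z_mat_carrier z_inv_carrier ij] ij by (simp add: z_mat_z_inv)
    then show "L.rel (\<Sum>k<n. z_mat n $$ (i, k) * z_inv n $$ (k, j)) (if i = j then 1 else 0)"
      by (simp add: L.rel_zero L.rel_one)
  qed

  \<comment> \<open>Multiply the congruence \<open>H W = 1\<close> on the left by \<open>A\<close>;
    since \<open>A H = 1\<close> holds exactly, \<open>W\<close> is congruent to
    \<open>A\<close>.\<close>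
  have W_inv_coeff: "K.rel (W r j) (inv_coeff r j)" if r: "r < n" and j: "j < n" for r j
  proof -
    have "K.rel (\<Sum>i<n. inv_coeff r i * (\<Sum>k<n. H_mat i k * W k j))
        (\<Sum>i<n. inv_coeff r i * (if i = j then 1 else 0))"
      using r j by (intro K.rel_sum K.rel_mult K_refl inv_coeff_C HW) auto
    moreover have "(\<Sum>i<n. inv_coeff r i * (if i = j then 1 else 0)) = inv_coeff r j"
      using j by (subst sum.remove[of _ j]) auto
    moreover have "(\<Sum>i<n. inv_coeff r i * (\<Sum>k<n. H_mat i k * W k j)) =
        (\<Sum>k<n. (\<Sum>i<n. inv_coeff r i * H_mat i k) * W k j)"
      unfolding sum_distrib_left sum_distrib_right by (subst sum.swap) (simp add: mult.assoc)
    moreover have "\<dots> = W r j"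
      using r by (simp add: inv_coeff_H_mat) (subst sum.remove[of _ r], auto)
    ultimately show ?thesis by simp
  qed

  have w: "L.rel (z_inv n $$ (i, j)) (inv_coeff i j)" if "i < n" "j < n" for i j
    using L_trans[OF W W_inv_coeff] that by simp

  have conjugate: "L.rel ((z_inv n * B * z_mat n) $$ (i, j)) (\<Sum>k<n. (\<Sum>l<n. inv_coeff i l * b l k) * H_mat k j)"
    if B: "B \<in> carrier_mat n n" and rel: "\<And>l k. l < n \<Longrightarrow> k < n \<Longrightarrow> L.rel (B $$ (l, k)) (b l k)"
      and ij: "i < n" "j < n" for B b i j
  proof -
    have "(z_inv n * B * z_mat n) $$ (i, j) = (\<Sum>k<n. (z_inv n * B) $$ (i, k) * z_mat n $$ (k, j))"
      using ij by (intro mat_mult_index_sum mult_carrier_mat[OF z_inv_carrier B] z_mat_carrier)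
    also have "\<dots> = (\<Sum>k<n. (\<Sum>l<n. z_inv n $$ (i, l) * B $$ (l, k)) * z_mat n $$ (k, j))"
      using ij by (intro sum.cong refl arg_cong2[where f = "(*)"] mat_mult_index_sum[OF z_inv_carrier B]) auto
    finally show ?thesis
      using ij by (auto intro!: L.rel_sum L.rel_mult w rel z)
  qed

  have nu: "\<phi> (nu n (Suc i) (Suc j)) = Q_class n ((- 1) ^ (i - j) * qvar (Suc j) (Suc i))"
    if ji: "j < i" and i: "i < n" for i j
  proof -
    let ?b = "\<lambda>l k :: nat. if k = Suc l then 1 else 0 :: xq zpoly"
    let ?S = "\<Sum>k<n. (\<Sum>l<n. inv_coeff i l * ?b l k) * H_mat k j"
    let ?q = "\<lambda>a. (- 1) ^ (a + i) * qvar (Suc a) (Suc i)"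
    have nu_rel: "L.rel (nu n (Suc i) (Suc j)) ?S"
      unfolding nu_def diff_Suc_1 using ji i
      by (intro conjugate) (auto simp: N_mat_def L.rel_zero L.rel_one)
    \<comment> \<open>The shifted row is \<open>t p_i\<close>, expanded into rows
      \<open>i + 1\<close>, \<open>i\<close> and \<open>a < i\<close> of \<open>A\<close>. Times
      \<open>H\<close>, the rows up to \<open>i\<close> become unit vectors, so at column
      \<open>j\<close> they leave only \<open>?q j\<close>.\<close>
    have "?S = (\<Sum>k<n. (inv_coeff (Suc i) k + xvar (Suc i) * inv_coeff i k +
        (\<Sum>a<i. ?q a * inv_coeff a k)) * H_mat k j)"
      by (intro sum.cong refl) (simp add: sum_shift_row inv_coeff_shift)
    also have "\<dots> = (\<Sum>k<n. inv_coeff (Suc i) k * H_mat k j) +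
        xvar (Suc i) * (\<Sum>k<n. inv_coeff i k * H_mat k j) +
        (\<Sum>a<i. ?q a * (\<Sum>k<n. inv_coeff a k * H_mat k j))"
      by (simp add: ring_distribs sum.distrib sum_distrib_left sum_distrib_right mult.assoc sum.swap[of _ "{..<i}"])
    also have "(\<Sum>a<i. ?q a * (\<Sum>k<n. inv_coeff a k * H_mat k j)) = ?q j"
    proof -
      have "(\<Sum>a<i. ?q a * (\<Sum>k<n. inv_coeff a k * H_mat k j)) = (\<Sum>a<i. if a = j then ?q j else 0)"
        using i by (intro sum.cong refl) (simp add: inv_coeff_H_mat)
      then show ?thesis using ji by simp
    qed
    also have "xvar (Suc i) * (\<Sum>k<n. inv_coeff i k * H_mat k j) = 0"
      using ji i by (simp add: inv_coeff_H_mat)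
    finally have S: "?S = (\<Sum>k<n. inv_coeff (Suc i) k * H_mat k j) + ?q j" by simp
    \<comment> \<open>If \<open>i + 1 < n\<close>, this is an off-diagonal entry of
      \<open>A H = 1\<close>. If \<open>i + 1 = n\<close>, every coefficient of \<open>p_n\<close>
      below \<open>t^n\<close> lies in the ideal.\<close>
    have "K.rel (\<Sum>k<n. inv_coeff (Suc i) k * H_mat k j) 0"
    proof (cases "Suc i < n")
      case True
      then show ?thesis using ji K.rel_zero by (simp add: inv_coeff_H_mat)
    next
      case False
      then have n: "Suc i = n" using i by simp
      have "K.rel (inv_coeff n k * H_mat k j) (0 * H_mat k j)" if "k < n" for k
      proof (intro K.rel_mult K_refl H_C that)
        show "K.rel (inv_coeff n k) 0"
          using inv_coeff_C[of n k] Q_class_eq_zero[OF inv_coeff_n_in_Q_ideal[OF that]]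
          by (simp add: K.rel_def R_ring_eq zpoly_ring_zero_closed)
      qed
      then have "K.rel (\<Sum>k<n. inv_coeff n k * H_mat k j) (\<Sum>k<n. 0 * H_mat k j)"
        by (intro K.rel_sum) simp
      then show ?thesis by (simp add: n)
    qed
    moreover have "?q j \<in> ?C"
      unfolding R_ring_eq using ji i
      by (intro zpoly_ring_mult_closed zpoly_ring_minus_one_power_closed zpoly_ring_var_closed)
        (simp add: xq_vars_def)
    ultimately have "K.rel ?S (?q j)"
      unfolding S using K.rel_add[OF _ K_refl] by fastforce
    then have "L.rel (nu n (Suc i) (Suc j)) (?q j)" by (rule L_trans[OF nu_rel])
    \<comment> \<open>\<open>i + j\<close> and \<open>i - j\<close> have the same parity.\<close>
    moreover have "(- 1) ^ (j + i) = ((- 1) ^ (i - j) :: xq zpoly)"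
      using ji by (simp add: minus_one_power_iff)
    ultimately show ?thesis by (simp add: L.rel_def)
  qed

  have xi: "\<phi> (xi n (Suc i) (Suc j)) = Q_class n (F_poly i (Suc j))"
    if ji: "j < i" and i: "i < n" for i j
  proof -
    let ?b = "\<lambda>l k :: nat. if l = k then of_nat (Suc k) else 0 :: xq zpoly"
    have "L.rel (xi n (Suc i) (Suc j)) (\<Sum>k<n. (\<Sum>l<n. inv_coeff i l * ?b l k) * H_mat k j)"
      unfolding xi_def diff_Suc_1 using ji i
      by (intro conjugate) (auto simp: S_mat_def L.rel_zero L.rel_of_nat simp del: of_nat_Suc)
    also have "(\<Sum>k<n. (\<Sum>l<n. inv_coeff i l * ?b l k) * H_mat k j) =
        (\<Sum>k<n. inv_coeff i k * of_nat (Suc k) * H_mat k j)"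
      by (intro sum.cong refl arg_cong2[where f = "(*)"]) (subst sum.remove, auto)
    also have "\<dots> = F_poly i (Suc j)"
      using ji i by (rule F_poly_eq_inv_coeff_sum)
    finally show ?thesis by (simp add: L.rel_def)
  qed

  show ?thesis
  proof (intro allI impI)
    fix i j assume ij: "1 \<le> j \<and> j < i \<and> i \<le> n"
    then obtain i' j' where "i = Suc i'" "j = Suc j'" "j' < i'" "i' < n"
      by (cases i; cases j) auto
    then show "\<phi> (nu n i j) = Q_class n ((- 1) ^ (i - j) * qvar j i) \<and>
        \<phi> (xi n i j) = Q_class n (F_poly (i - 1) j)"
      using nu xi by simp
  qed
qed

end
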